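(* For every $\delta\in[0,1)$, with $x=\left\lfloor\frac{\delta}{1-\delta}\right\rfloor$, it holds that $$\mathrm{cobs}(\mathbb C_{\le\delta})=\min\big(\{\mathcal G^1,\mathcal G^2\}\cup\{\mathcal G^T : T\in\mathcal T_{x+2}\}\big).$$
   Context: Graphs are finite, without loops or multiple edges, and considered up to isomorphism. All graph classes considered are minor-closed and proper (a class is proper if it does not contain all graphs). For a graph class $\mathcal G$ let $\mathrm{ex}(\mathcal G,n)=\max\{|E(G)| : G\in\mathcal G,\ |V(G)|=n\}$. The limiting density of an infinite class is $\delta(\mathcal G)=\lim_{n\to\infty}\mathrm{ex}(\mathcal G,n)/n$; if $\mathcal G$ is finite then $\delta(\mathcal G)=-\infty$. $\mathbb C_{\le\delta}$ is the set of all minor-closed graph classes $\mathcal G$ with $\delta(\mathcal G)\le\delta$. For a set $\mathbb C$ of minor-closed classes, $\mathrm{cobs}(\mathbb C)$ is the set of all $\subseteq$-minimal minor-closed graph classes that do not belong to $\mathbb C$. $k\cdot H$ is the disjoint union of $k$ copies of $H$, and $\mathcal G^H$ is the class of all minors of the graphs $k\cdot H$, $k\ge1$. $\mathcal G^1=\mathcal G^{K_3}$ is the class of all minors of the graphs $k\cdot K_3$, and $\mathcal G^2$ is the class of all minors of the stars $K_{1,k}$, $k\ge1$. $\mathcal T_a$ is the set of all trees on $a$ vertices. For a finite set $\mathbb L$ of minor-closed graph classes, $\min(\mathbb L)$ is the set of $\subseteq$-minimal elements of $\mathbb L$. *)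

theory Defs
  imports Complex_Main "HOL-Library.Extended_Real"
begin

datatype 'a graph = Graph (verts: "'a set") (edges: "'a set set")

definition simple_graph :: "'a graph \<Rightarrow> bool" where
  "simple_graph G \<longleftrightarrow>
     finite (verts G) \<and> (\<forall>e\<in>edges G. e \<subseteq> verts G \<and> card e = 2)"

definition isomorphic :: "'a graph \<Rightarrow> 'b graph \<Rightarrow> bool" where
  "isomorphic G H \<longleftrightarrow>
     (\<exists>f. bij_betw f (verts G) (verts H) \<and> edges H = (\<lambda>e. f ` e) ` edges G)"

text \<open>\<open>S\<close> is nonempty and induces a connected subgraph of \<open>G\<close>.\<close>

definition connected_set :: "'a graph \<Rightarrow> 'a set \<Rightarrow> bool" where
  "connected_set G S \<longleftrightarrow> S \<subseteq> verts G \<and> S \<noteq> {} \<and>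
     (\<forall>u\<in>S. \<forall>v\<in>S. (u, v) \<in> {(a, b). a \<in> S \<and> b \<in> S \<and> {a, b} \<in> edges G}\<^sup>*)"

text \<open>Minors are given by branch sets: \<open>B v\<close> is the set of vertices of \<open>G\<close> that is contracted
  to the vertex \<open>v\<close> of \<open>H\<close>. The vertex types may differ, and a graph is a minor of all its
  isomorphic copies.\<close>

definition is_minor :: "'b graph \<Rightarrow> 'a graph \<Rightarrow> bool" where
  "is_minor H G \<longleftrightarrow> (\<exists>B.
     (\<forall>v\<in>verts H. connected_set G (B v)) \<and>
     (\<forall>u\<in>verts H. \<forall>v\<in>verts H. u \<noteq> v \<longrightarrow> B u \<inter> B v = {}) \<and>
     (\<forall>u v. {u, v} \<in> edges H \<longrightarrow> (\<exists>a\<in>B u. \<exists>b\<in>B v. {a, b} \<in> edges G)))"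

definition is_cycle :: "'a graph \<Rightarrow> 'a list \<Rightarrow> bool" where
  "is_cycle G c \<longleftrightarrow> 3 \<le> length c \<and> distinct c \<and>
     (\<forall>i<length c. {c ! i, c ! (Suc i mod length c)} \<in> edges G)"

definition is_tree :: "'a graph \<Rightarrow> bool" where
  "is_tree T \<longleftrightarrow>
     simple_graph T \<and> connected_set T (verts T) \<and> \<not> (\<exists>c. is_cycle T c)"

definition complete_graph :: "nat \<Rightarrow> nat graph" where
  "complete_graph n = Graph {..<n} {e. e \<subseteq> {..<n} \<and> card e = 2}"

definition star :: "nat \<Rightarrow> nat graph" where
  "star k = Graph {0..k} {{0, i} |i. i \<in> {1..k}}"

definition copies :: "nat \<Rightarrow> 'a graph \<Rightarrow> (nat \<times> 'a) graph" where
  "copies k H = Graph ({..<k} \<times> verts H) {Pair i ` e |i e. i < k \<and> e \<in> edges H}"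

text \<open>Every finite graph has an isomorphic copy on a set of natural numbers, so a class of graphs
  considered up to isomorphism is an isomorphism-closed set of graphs of type \<^typ>\<open>nat graph\<close>.
  Closure under isomorphism is part of closure under minors. The graph without vertices is
  admitted.\<close>

definition minor_closed :: "nat graph set \<Rightarrow> bool" where
  "minor_closed \<G> \<longleftrightarrow> (\<forall>G\<in>\<G>. simple_graph G) \<and>
     (\<forall>G\<in>\<G>. \<forall>H :: nat graph. simple_graph H \<and> is_minor H G \<longrightarrow> H \<in> \<G>)"

definition proper_minor_closed :: "nat graph set \<Rightarrow> bool" where
  "proper_minor_closed \<G> \<longleftrightarrow> minor_closed \<G> \<and> \<G> \<noteq> {G. simple_graph G}"

text \<open>Since members of a class are labelled graphs, finiteness means that there are finitely many
  isomorphism types.\<close>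

definition finite_class :: "nat graph set \<Rightarrow> bool" where
  "finite_class \<G> \<longleftrightarrow> finite (\<G> // {(G, H). isomorphic G H})"

text \<open>An infinite minor-closed class has members on \<open>n\<close> vertices for every \<open>n\<close>, so there the
  maximum is over a nonempty finite set.\<close>

definition ex :: "nat graph set \<Rightarrow> nat \<Rightarrow> nat" where
  "ex \<G> n = Max {card (edges G) |G. G \<in> \<G> \<and> card (verts G) = n}"

definition limiting_density :: "nat graph set \<Rightarrow> ereal" where
  "limiting_density \<G> =
     (if finite_class \<G> then -\<infinity> else lim (\<lambda>n. ereal (real (ex \<G> n) / real n)))"

definition classes_of_density_le :: "real \<Rightarrow> nat graph set set" where
  "classes_of_density_le \<delta> = {\<G>. proper_minor_closed \<G> \<and> limiting_density \<G> \<le> ereal \<delta>}"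

definition min_classes :: "nat graph set set \<Rightarrow> nat graph set set" where
  "min_classes L = {\<G>\<in>L. \<forall>\<H>\<in>L. \<H> \<subseteq> \<G> \<longrightarrow> \<H> = \<G>}"

definition cobs :: "nat graph set set \<Rightarrow> nat graph set set" where
  "cobs C = min_classes {\<G>. proper_minor_closed \<G> \<and> \<G> \<notin> C}"

definition class_of_copies :: "'a graph \<Rightarrow> nat graph set" where
  "class_of_copies H = {G. simple_graph G \<and> (\<exists>k\<ge>1. is_minor G (copies k H))}"

definition class1 :: "nat graph set" where
  "class1 = class_of_copies (complete_graph 3)"

definition class2 :: "nat graph set" where
  "class2 = {G. simple_graph G \<and> (\<exists>k\<ge>1. is_minor G (star k))}"

definition trees :: "nat \<Rightarrow> nat graph set" where
  "trees a = {T. is_tree T \<and> card (verts T) = a}"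

end

theory Submission imports Defs begin

text \<open>
  Write \<open>L\<close> for the finite set of classes on the right. Everything follows from the equivalence: a
  proper minor-closed class has density above \<open>\<delta>\<close> iff it contains a member of \<open>L\<close>; the minimal
  elements of the upward closure of \<open>L\<close> are those of \<open>L\<close>.

  If a class contains no member of \<open>L\<close>, its graphs have bounded degree, boundedly many disjoint
  cycles and boundedly many disjoint connected sets of \<open>x + 2\<close> vertices. Deleting a maximal packing
  of such sets leaves components with at most \<open>x + 1\<close> vertices, all but boundedly many of them trees,
  so a graph on \<open>n\<close> vertices has at most \<open>x / (x + 1) * n + O(1)\<close> edges, and \<open>x / (x + 1) \<le> \<delta>\<close>.

  Conversely, the members of \<open>L\<close> have graphs of density tending to \<open>1\<close>, \<open>1\<close> and \<open>(x + 1) / (x + 2)\<close>,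
  all above \<open>\<delta>\<close>. To transfer this to a larger class one needs that \<open>ex \<G> n / n\<close> converges
  for every infinite proper minor-closed class \<open>\<G>\<close>. A graph without a fixed complete minor has small
  balanced separators; splitting recursively yields pieces of bounded size that cover all edges and
  have total size at most \<open>(1 + \<eta>) * n\<close>, and the densest pieces together form an induced subgraph
  on any prescribed large number \<open>m\<close> of vertices that is almost as dense as the whole graph. Hence
  \<open>ex \<G> n / n\<close> is decreasing up to a factor tending to \<open>1\<close>.
\<close>

section \<open>Connected sets and minors\<close>

text \<open>The relation inside \<open>connected_set\<close>, named so that its symmetry and its
  monotonicity in \<open>S\<close> can be quoted.\<close>

definition adj :: "'a graph \<Rightarrow> 'a set \<Rightarrow> ('a \<times> 'a) set" where
  "adj G S = {(a, b). a \<in> S \<and> b \<in> S \<and> {a, b} \<in> edges G}"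

definition induced :: "'a graph \<Rightarrow> 'a set \<Rightarrow> 'a graph" where
  "induced G S = Graph (verts G \<inter> S) {e \<in> edges G. e \<subseteq> S}"

definition touching :: "'a graph \<Rightarrow> 'a set \<Rightarrow> 'a set \<Rightarrow> bool" where
  "touching G X Y \<longleftrightarrow> (\<exists>a\<in>X. \<exists>b\<in>Y. {a, b} \<in> edges G)"

lemma verts_induced [simp]: "verts (induced G S) = verts G \<inter> S"
  and edges_induced [simp]: "edges (induced G S) = {e \<in> edges G. e \<subseteq> S}"
  by (simp_all add: induced_def)

lemma touching_sym: "touching G X Y \<Longrightarrow> touching G Y X"
  unfolding touching_def by (metis insert_commute)

lemma touching_mono: "touching G X Y \<Longrightarrow> X \<subseteq> X' \<Longrightarrow> Y \<subseteq> Y' \<Longrightarrow> touching G X' Y'"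
  unfolding touching_def by blast

lemma simple_graph_induced: "simple_graph G \<Longrightarrow> simple_graph (induced G S)"
  by (auto simp: simple_graph_def)

lemma simple_graph_edge:
  assumes "simple_graph G" "{a, b} \<in> edges G"
  shows "a \<in> verts G" "b \<in> verts G" "a \<noteq> b"
  using assms by (auto simp: simple_graph_def)

lemma finite_edges: "simple_graph G \<Longrightarrow> finite (edges G)"
  by (rule finite_subset[of _ "Pow (verts G)"]) (auto simp: simple_graph_def)

lemma simple_graph_edgeE:
  assumes "simple_graph G" "e \<in> edges G"
  obtains a b where "e = {a, b}" "a \<noteq> b" "a \<in> verts G" "b \<in> verts G"
  using assms unfolding simple_graph_def by (metis card_2_iff insert_subset)

lemma connected_set_iff_adj:
  "connected_set G S \<longleftrightarrow> S \<subseteq> verts G \<and> S \<noteq> {} \<and> (\<forall>u\<in>S. \<forall>v\<in>S. (u, v) \<in> (adj G S)\<^sup>*)"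
  by (simp add: connected_set_def adj_def)

lemma adj_mono: "S \<subseteq> S' \<Longrightarrow> adj G S \<subseteq> adj G S'"
  by (auto simp: adj_def)

lemma sym_adj: "sym (adj G S)"
  by (auto simp: adj_def sym_def insert_commute)

text \<open>By symmetry of \<open>adj G S\<close>, two vertices reachable from the root
  \<open>r\<close> reach each other through \<open>r\<close>.\<close>

lemma connected_set_rootI:
  assumes "S \<subseteq> verts G" "r \<in> S" "\<And>v. v \<in> S \<Longrightarrow> (r, v) \<in> (adj G S)\<^sup>*"
  shows "connected_set G S"
proof -
  have "(u, v) \<in> (adj G S)\<^sup>*" if "u \<in> S" "v \<in> S" for u v
    using that assms(3) sym_rtrancl[OF sym_adj] by (meson rtrancl_trans symD)
  then show ?thesis using assms by (auto simp: connected_set_iff_adj)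
qed

lemma connected_set_subset: "connected_set G S \<Longrightarrow> S \<subseteq> verts G"
  and connected_set_nonempty: "connected_set G S \<Longrightarrow> S \<noteq> {}"
  by (auto simp: connected_set_def)

lemma connected_set_singleton: "v \<in> verts G \<Longrightarrow> connected_set G {v}"
  by (rule connected_set_rootI) auto

lemma connected_set_Union_root:
  assumes "\<And>S. S \<in> F \<Longrightarrow> connected_set G S \<and> r \<in> S" "F \<noteq> {}"
  shows "connected_set G (\<Union>F)"
proof (rule connected_set_rootI[of _ _ r])
  show "\<Union>F \<subseteq> verts G" using assms connected_set_subset by blast
  show "r \<in> \<Union>F" using assms by blast
  fix v assume "v \<in> \<Union>F"
  then obtain S where S: "S \<in> F" "v \<in> S" by blast
  then have "(r, v) \<in> (adj G S)\<^sup>*" using assms(1) by (auto simp: connected_set_iff_adj)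
  then show "(r, v) \<in> (adj G (\<Union>F))\<^sup>*"
    using rtrancl_mono[OF adj_mono] S(1) by (metis Union_upper subsetD)
qed

lemma connected_set_Un:
  assumes "connected_set G S" "connected_set G T" "S \<inter> T \<noteq> {}"
  shows "connected_set G (S \<union> T)"
proof -
  obtain r where "r \<in> S" "r \<in> T" using assms by blast
  then show ?thesis using connected_set_Union_root[of "{S, T}" G r] assms by auto
qed

lemma connected_set_insert:
  assumes "connected_set G S" "a \<in> S" "b \<in> verts G" "{a, b} \<in> edges G"
  shows "connected_set G (insert b S)"
proof -
  have "connected_set G {a, b}"
  proof (rule connected_set_rootI[of _ _ a])
    show "{a, b} \<subseteq> verts G" using assms connected_set_subset by blast
    fix v assume "v \<in> {a, b}"
    then show "(a, v) \<in> (adj G {a, b})\<^sup>*" using assms(4) by (auto simp: adj_def)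
  qed simp
  then have "connected_set G (S \<union> {a, b})" using assms by (intro connected_set_Un) auto
  then show ?thesis using assms(2) by (simp add: insert_absorb)
qed

text \<open>A walk in \<open>S\<close> from a vertex of \<open>X\<close> to one outside has a first
  step that leaves \<open>X\<close>.\<close>

lemma connected_set_crossing:
  assumes "connected_set G S" "X \<subseteq> S" "X \<noteq> S" "X \<noteq> {}"
  obtains a b where "a \<in> X" "b \<in> S - X" "{a, b} \<in> edges G"
proof -
  obtain u v where u: "u \<in> X" and v: "v \<in> S - X" using assms by blast
  then have "(u, v) \<in> (adj G S)\<^sup>*" using assms by (auto simp: connected_set_iff_adj)
  then have "v \<notin> X \<longrightarrow> (\<exists>a\<in>X. \<exists>b\<in>S - X. {a, b} \<in> edges G)"
  proof induction
    case base then show ?case using u by simp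
  next
    case (step y z) then show ?case by (auto simp: adj_def)
  qed
  then show ?thesis using that v by blast
qed

text \<open>This is the component of \<open>a\<close> in \<open>S\<close>. Every vertex on a walk
  from \<open>a\<close> is itself reachable from \<open>a\<close>, so the walk can be repeated with
  all its vertices inside the component.\<close>

lemma reachable_connected:
  assumes "S \<subseteq> verts G" "a \<in> S"
  shows "connected_set G {w. (a, w) \<in> (adj G S)\<^sup>*}" "{w. (a, w) \<in> (adj G S)\<^sup>*} \<subseteq> S"
proof -
  let ?X = "{w. (a, w) \<in> (adj G S)\<^sup>*}"
  have "w \<in> S" if "(a, w) \<in> (adj G S)\<^sup>*" for w
    using that by (induction) (use assms in \<open>auto simp: adj_def\<close>)
  then show sub: "?X \<subseteq> S" by blast
  have "(a, w) \<in> (adj G ?X)\<^sup>*" if "(a, w) \<in> (adj G S)\<^sup>*" for w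
    using that
  proof induction
    case (step y z)
    then have "(a, z) \<in> (adj G S)\<^sup>*" by auto
    then have "(y, z) \<in> adj G ?X" using step by (auto simp: adj_def)
    then show ?case using step by auto
  qed auto
  then show "connected_set G ?X"
    using sub assms by (intro connected_set_rootI[of _ _ a]) auto
qed

text \<open>\<open>X\<close> is the component of \<open>a\<close> in \<open>S - {b}\<close>. Some
  edge of \<open>S\<close> leaves it, and any end other than \<open>b\<close> would belong to the
  component.\<close>

lemma connected_set_split:
  assumes "connected_set G S" "a \<in> S" "b \<in> S" "a \<noteq> b"
  obtains X where "X \<subseteq> S - {b}" "a \<in> X" "connected_set G X" "touching G X {b}"
proof -
  let ?X = "{w. (a, w) \<in> (adj G (S - {b}))\<^sup>*}"
  have S: "S - {b} \<subseteq> verts G" using assms connected_set_subset by blast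
  have X: "connected_set G ?X" "?X \<subseteq> S - {b}"
    using reachable_connected[OF S, of a] assms by auto
  have "a \<in> ?X" by simp
  obtain u c where u: "u \<in> ?X" "c \<in> S - ?X" "{u, c} \<in> edges G"
    using connected_set_crossing[OF assms(1), of ?X] X \<open>a \<in> ?X\<close> assms(3) by blast
  have "c = b"
  proof (rule ccontr)
    assume "c \<noteq> b"
    then have "(u, c) \<in> adj G (S - {b})" using u X by (auto simp: adj_def)
    then have "(a, c) \<in> (adj G (S - {b}))\<^sup>*"
      using u(1) by (auto intro: rtrancl_into_rtrancl)
    then show False using u by blast
  qed
  then have "touching G ?X {b}" using u by (auto simp: touching_def)
  then show ?thesis using that X \<open>a \<in> ?X\<close> by blast
qed

text \<open>A walk in \<open>S\<close> lifts to the union: move inside \<open>C u\<close> by its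
  connectedness and cross to the next set where the two touch.\<close>

lemma connected_set_UN:
  assumes "connected_set G S" "\<And>u. u \<in> S \<Longrightarrow> connected_set F (C u)"
    and "\<And>u v. {u, v} \<in> edges G \<Longrightarrow> touching F (C u) (C v)"
  shows "connected_set F (\<Union>u\<in>S. C u)"
proof -
  let ?U = "\<Union>u\<in>S. C u"
  obtain r where r: "r \<in> S" using assms connected_set_nonempty by blast
  obtain p where p: "p \<in> C r" using assms(2)[OF r] connected_set_nonempty by blast
  have inner: "(x, y) \<in> (adj F ?U)\<^sup>*" if "u \<in> S" "x \<in> C u" "y \<in> C u" for u x y
  proof -
    have "(x, y) \<in> (adj F (C u))\<^sup>*" using that assms(2) by (auto simp: connected_set_iff_adj)
    then show ?thesis using rtrancl_mono[OF adj_mono[of "C u" ?U]] that by blast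
  qed
  have "\<forall>q\<in>C v. (p, q) \<in> (adj F ?U)\<^sup>*" if "v \<in> S" for v
  proof -
    have "(r, v) \<in> (adj G S)\<^sup>*" using assms(1) r that by (auto simp: connected_set_iff_adj)
    then show ?thesis
    proof induction
      case base then show ?case using inner r p by blast
    next
      case (step y z)
      then have yz: "y \<in> S" "z \<in> S" "{y, z} \<in> edges G" by (auto simp: adj_def)
      then obtain a b where ab: "a \<in> C y" "b \<in> C z" "{a, b} \<in> edges F"
        using assms(3) unfolding touching_def by meson
      then have "(a, b) \<in> adj F ?U" using yz by (auto simp: adj_def)
      then have "(p, b) \<in> (adj F ?U)\<^sup>*" using step ab by auto
      then show ?case using inner[OF yz(2) ab(2)] by (meson rtrancl_trans)
    qed
  qed
  moreover have "?U \<subseteq> verts F" using assms(2) connected_set_subset by blast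
  ultimately show ?thesis using r p by (intro connected_set_rootI[of _ _ p]) auto
qed

lemma connected_set_induced:
  "connected_set (induced G S) X \<Longrightarrow> connected_set G X \<and> X \<subseteq> S"
proof -
  assume X: "connected_set (induced G S) X"
  have "adj (induced G S) X \<subseteq> adj G X" by (auto simp: adj_def)
  from rtrancl_mono[OF this] show ?thesis using X unfolding connected_set_iff_adj by (simp add: subset_iff)
qed

lemma connected_set_in_induced:
  assumes "connected_set G X" "X \<subseteq> S" shows "connected_set (induced G S) X"
proof -
  have "adj (induced G S) X = adj G X" using assms by (auto simp: adj_def)
  then show ?thesis using assms by (auto simp: connected_set_iff_adj)
qed

text \<open>Vertices are added one at a time along edges leaving the current set. So connected
  subsets of every size up to \<open>card S\<close> arise, and an invariant \<open>P\<close> can be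
  carried along.\<close>

lemma connected_set_grow:
  assumes S: "connected_set G S" "finite S"
    and base: "\<And>r. r \<in> S \<Longrightarrow> P {r}"
    and step: "\<And>X a b. X \<subseteq> S \<Longrightarrow> connected_set G X \<Longrightarrow> P X \<Longrightarrow> a \<in> X \<Longrightarrow> b \<in> S - X \<Longrightarrow>
      {a, b} \<in> edges G \<Longrightarrow> P (insert b X)"
    and j: "1 \<le> j" "j \<le> card S"
  shows "\<exists>X\<subseteq>S. card X = j \<and> connected_set G X \<and> P X"
  using j
proof (induction j rule: dec_induct)
  case base
  obtain r where "r \<in> S" using S connected_set_nonempty by blast
  then show ?case
    using assms(3) connected_set_singleton[of r G] connected_set_subset[OF S(1)]
    by (intro exI[of _ "{r}"]) auto
next
  case (step j)
  then obtain X where X: "X \<subseteq> S" "card X = j" "connected_set G X" "P X" by auto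
  then have "X \<noteq> S" using step by auto
  then obtain a b where ab: "a \<in> X" "b \<in> S - X" "{a, b} \<in> edges G"
    using connected_set_crossing[OF S(1) X(1)] connected_set_nonempty[OF X(3)] by blast
  have "connected_set G (insert b X)"
    using connected_set_insert[OF X(3) ab(1) _ ab(3)] ab(2) connected_set_subset[OF S(1)] by blast
  moreover have "card (insert b X) = Suc j"
    using X S ab by (simp add: finite_subset)
  ultimately show ?case using assms(4)[OF X(1,3,4) ab] X ab
    by (intro exI[of _ "insert b X"]) auto
qed

text \<open>The growth is carried to size \<open>card S\<close>, where the subset reached can only
  be \<open>S\<close> itself.\<close>

lemma connected_set_induct [consumes 2, case_names singleton insert]:
  assumes S: "connected_set G S" "finite S"
    and base: "\<And>r. r \<in> S \<Longrightarrow> P {r}"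
    and step: "\<And>X a b. X \<subseteq> S \<Longrightarrow> connected_set G X \<Longrightarrow> P X \<Longrightarrow> a \<in> X \<Longrightarrow> b \<in> S - X \<Longrightarrow>
      {a, b} \<in> edges G \<Longrightarrow> P (insert b X)"
  shows "P S"
proof -
  have "1 \<le> card S"
    using S connected_set_nonempty[OF S(1)] by (simp add: Suc_le_eq card_gt_0_iff)
  then have "\<exists>X\<subseteq>S. card X = card S \<and> connected_set G X \<and> P X"
    using assms by (intro connected_set_grow) auto
  then obtain X where X: "X \<subseteq> S" "card X = card S" "P X" by blast
  then show ?thesis using card_subset_eq[OF S(2)] by metis
qed

section \<open>The minor relation and ways to exhibit minors\<close>

lemma is_minorI:
  assumes "\<And>v. v \<in> verts H \<Longrightarrow> connected_set G (B v)"
    and "\<And>u v. u \<in> verts H \<Longrightarrow> v \<in> verts H \<Longrightarrow> u \<noteq> v \<Longrightarrow> B u \<inter> B v = {}"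
    and "\<And>u v. {u, v} \<in> edges H \<Longrightarrow> touching G (B u) (B v)"
  shows "is_minor H G"
  unfolding is_minor_def using assms unfolding touching_def by (intro exI[of _ B]) auto

lemma is_minorE:
  assumes "is_minor H G"
  obtains B where "\<And>v. v \<in> verts H \<Longrightarrow> connected_set G (B v)"
    and "\<And>u v. u \<in> verts H \<Longrightarrow> v \<in> verts H \<Longrightarrow> u \<noteq> v \<Longrightarrow> B u \<inter> B v = {}"
    and "\<And>u v. {u, v} \<in> edges H \<Longrightarrow> touching G (B u) (B v)"
  using assms unfolding is_minor_def touching_def by metis

text \<open>Branch sets compose: that of \<open>v\<close> is the union of the sets
  \<open>C u\<close> over \<open>u\<close> in \<open>B v\<close>.\<close>

lemma is_minor_trans:
  assumes "is_minor H G" "is_minor G F"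
  shows "is_minor H F"
proof -
  from assms(1) obtain B where B: "\<And>v. v \<in> verts H \<Longrightarrow> connected_set G (B v)"
    "\<And>u v. u \<in> verts H \<Longrightarrow> v \<in> verts H \<Longrightarrow> u \<noteq> v \<Longrightarrow> B u \<inter> B v = {}"
    "\<And>u v. {u, v} \<in> edges H \<Longrightarrow> touching G (B u) (B v)"
    by (rule is_minorE) blast
  from assms(2) obtain C where C: "\<And>v. v \<in> verts G \<Longrightarrow> connected_set F (C v)"
    "\<And>u v. u \<in> verts G \<Longrightarrow> v \<in> verts G \<Longrightarrow> u \<noteq> v \<Longrightarrow> C u \<inter> C v = {}"
    "\<And>u v. {u, v} \<in> edges G \<Longrightarrow> touching F (C u) (C v)"
    by (rule is_minorE) blast
  show ?thesis
  proof (rule is_minorI[where B = "\<lambda>v. \<Union>u\<in>B v. C u"])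
    fix v assume "v \<in> verts H"
    from B(1)[OF this] show "connected_set F (\<Union>u\<in>B v. C u)"
    proof (rule connected_set_UN)
      fix u assume "u \<in> B v"
      then show "connected_set F (C u)"
        using C(1) connected_set_subset[OF B(1)[OF \<open>v \<in> verts H\<close>]] by blast
    qed (rule C(3))
  next
    fix u v assume uv: "u \<in> verts H" "v \<in> verts H" "u \<noteq> v"
    then have "B u \<subseteq> verts G" "B v \<subseteq> verts G" "B u \<inter> B v = {}"
      using connected_set_subset[OF B(1)] B(2) by auto
    then show "(\<Union>u\<in>B u. C u) \<inter> (\<Union>u\<in>B v. C u) = {}"
      using C(2) by (fastforce simp: subset_iff disjoint_iff)
  next
    fix u v assume "{u, v} \<in> edges H"
    then obtain a b where "a \<in> B u" "b \<in> B v" "{a, b} \<in> edges G"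
      using B(3) unfolding touching_def by meson
    then show "touching F (\<Union>u\<in>B u. C u) (\<Union>u\<in>B v. C u)"
      by (meson UN_upper touching_mono[OF C(3)])
  qed
qed

lemma is_minor_inj:
  assumes "inj_on g (verts H)" "g ` verts H \<subseteq> verts G"
    and "\<And>u v. {u, v} \<in> edges H \<Longrightarrow> {g u, g v} \<in> edges G"
  shows "is_minor H G"
  by (rule is_minorI[where B = "\<lambda>v. {g v}"])
    (use assms in \<open>auto simp: touching_def inj_on_def intro: connected_set_singleton\<close>)

lemma is_minor_subgraph:
  "verts H \<subseteq> verts G \<Longrightarrow> edges H \<subseteq> edges G \<Longrightarrow> is_minor H G"
  by (rule is_minor_inj[of id]) auto

lemma is_minor_induced: "is_minor (induced G S) G"
  by (rule is_minor_subgraph) auto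

text \<open>Members of classes are graphs on naturals, while \<open>copies k H\<close> has pairs as
  vertices; this moves such graphs into a class.\<close>

lemma exists_nat_copy:
  fixes H :: "'a graph"
  assumes "simple_graph H"
  obtains H' :: "nat graph" where "simple_graph H'" "is_minor H' H" "is_minor H H'"
    "card (verts H') = card (verts H)" "card (edges H') = card (edges H)"
proof -
  have fin: "finite (verts H)" using assms by (simp add: simple_graph_def)
  from finite_imp_inj_to_nat_seg[OF this] obtain f :: "'a \<Rightarrow> nat" where f: "inj_on f (verts H)"
    by metis
  let ?H = "Graph (f ` verts H) ((`) f ` edges H)"
  have sub: "e \<subseteq> verts H" "card e = 2" if "e \<in> edges H" for e
    using assms that by (simp_all add: simple_graph_def)
  have inj: "inj_on ((`) f) (edges H)"
    using inj_on_image_eq_iff[OF f] sub(1) by (intro inj_onI) simp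
  have "card (f ` e) = 2" if "e \<in> edges H" for e
    using sub[OF that] f by (metis card_image inj_on_subset)
  then have "simple_graph ?H" using fin sub by (auto simp: simple_graph_def)
  moreover have "is_minor H ?H"
  proof (rule is_minor_inj[of f])
    fix u v assume "{u, v} \<in> edges H"
    then have "f ` {u, v} \<in> edges ?H" unfolding graph.sel by (rule imageI)
    then show "{f u, f v} \<in> edges ?H" by simp
  qed (simp_all add: f)
  moreover have "is_minor ?H H"
  proof (rule is_minor_inj[of "inv_into (verts H) f"])
    fix u v assume "{u, v} \<in> edges ?H"
    then obtain e where e: "e \<in> edges H" "f ` e = {u, v}" by auto
    then have "inv_into (verts H) f ` {u, v} = e"
      using inv_into_image_cancel[OF f sub(1)[OF e(1)]] by simp
    then show "{inv_into (verts H) f u, inv_into (verts H) f v} \<in> edges H" using e by simp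
  next
    show "inv_into (verts H) f ` verts ?H \<subseteq> verts H" by (auto intro: inv_into_into)
  qed (simp add: inj_on_inv_into)
  ultimately show ?thesis using that[of ?H] card_image[OF f] card_image[OF inj] by simp
qed

text \<open>All vertices of a complete graph look alike, so the branch sets may come as an unindexed
  family and be enumerated in any order.\<close>

lemma is_minor_complete_graph:
  assumes "finite M" "card M = t" "\<And>X. X \<in> M \<Longrightarrow> connected_set G X" "pairwise disjnt M"
    and "\<And>X Y. X \<in> M \<Longrightarrow> Y \<in> M \<Longrightarrow> X \<noteq> Y \<Longrightarrow> touching G X Y"
  shows "is_minor (complete_graph t) G"
proof -
  obtain B where B: "bij_betw B {..<t} M"
    using ex_bij_betw_nat_finite[OF assms(1)] assms(2) by (auto simp: atLeast0LessThan)
  have BM: "B i \<in> M" if "i < t" for i using B that by (auto simp: bij_betw_def)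
  have Bne: "B i \<noteq> B j" if "i < t" "j < t" "i \<noteq> j" for i j
    using B that by (auto simp: bij_betw_def inj_on_def)
  show ?thesis
  proof (rule is_minorI[where B = B])
    fix u v assume "u \<in> verts (complete_graph t)" "v \<in> verts (complete_graph t)" "u \<noteq> v"
    then show "B u \<inter> B v = {}"
      using assms(4) BM Bne by (auto simp: complete_graph_def pairwise_def disjnt_def)
  next
    fix u v assume "{u, v} \<in> edges (complete_graph t)"
    then have "u < t" "v < t" "u \<noteq> v" by (auto simp: complete_graph_def)
    then show "touching G (B u) (B v)" by (intro assms(5) BM Bne)
  qed (use assms BM in \<open>auto simp: complete_graph_def\<close>)
qed

lemma is_minor_of_complete_graph:
  assumes "simple_graph H"
  shows "is_minor H (complete_graph (card (verts H)))"
proof -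
  have "finite (verts H)" using assms by (simp add: simple_graph_def)
  then obtain f where f: "bij_betw f (verts H) {..<card (verts H)}"
    using ex_bij_betw_finite_nat by (auto simp: atLeast0LessThan)
  show ?thesis
  proof (rule is_minor_inj[of f])
    fix u v assume "{u, v} \<in> edges H"
    then have "u \<in> verts H" "v \<in> verts H" "u \<noteq> v" using simple_graph_edge assms by metis+
    moreover from this have "f u \<noteq> f v" using f by (auto simp: bij_betw_def inj_on_def)
    ultimately show "{f u, f v} \<in> edges (complete_graph (card (verts H)))"
      using f by (auto simp: complete_graph_def bij_betw_def)
  qed (use f in \<open>auto simp: bij_betw_def complete_graph_def\<close>)
qed

text \<open>The branch set of \<open>(i, v)\<close> is the one that \<open>v\<close> has in the
  \<open>i\<close>-th host; disjointness between copies comes from the hosts.\<close>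

lemma is_minor_copies:
  assumes "\<And>i. i < k \<Longrightarrow> is_minor H (induced G (S i))"
    and "\<And>i j. i < k \<Longrightarrow> j < k \<Longrightarrow> i \<noteq> j \<Longrightarrow> S i \<inter> S j = {}"
  shows "is_minor (copies k H) G"
proof -
  have "\<exists>B. (\<forall>v\<in>verts H. connected_set (induced G (S i)) (B v)) \<and>
      (\<forall>u\<in>verts H. \<forall>v\<in>verts H. u \<noteq> v \<longrightarrow> B u \<inter> B v = {}) \<and>
      (\<forall>u v. {u, v} \<in> edges H \<longrightarrow> touching (induced G (S i)) (B u) (B v))" if "i < k" for i
    using assms(1)[OF that] by (rule is_minorE) blast
  then obtain B where B: "\<And>i v. i < k \<Longrightarrow> v \<in> verts H \<Longrightarrow> connected_set (induced G (S i)) (B i v)"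
      "\<And>i u v. i < k \<Longrightarrow> u \<in> verts H \<Longrightarrow> v \<in> verts H \<Longrightarrow> u \<noteq> v \<Longrightarrow> B i u \<inter> B i v = {}"
      "\<And>i u v. i < k \<Longrightarrow> {u, v} \<in> edges H \<Longrightarrow> touching (induced G (S i)) (B i u) (B i v)"
    by metis
  have sub: "connected_set G (B i v)" "B i v \<subseteq> S i" if "i < k" "v \<in> verts H" for i v
    using connected_set_induced[OF B(1)[OF that]] by auto
  show ?thesis
  proof (rule is_minorI[where B = "\<lambda>(i, v). B i v"])
    fix p q assume pq: "p \<in> verts (copies k H)" "q \<in> verts (copies k H)" "p \<noteq> q"
    obtain i u j v where "p = (i, u)" "q = (j, v)" by fastforce
    then show "(case p of (i, v) \<Rightarrow> B i v) \<inter> (case q of (i, v) \<Rightarrow> B i v) = {}"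
      using pq B(2)[of i u v] sub(2)[of i u] sub(2)[of j v] assms(2)[of i j]
      by (cases "i = j") (auto simp: copies_def)
  next
    fix p q assume "{p, q} \<in> edges (copies k H)"
    then obtain i e where e: "i < k" "e \<in> edges H" "{p, q} = Pair i ` e"
      by (auto simp: copies_def)
    obtain u v where p: "p = (i, u)" and q: "q = (i, v)" using e(3) by (metis imageE insertCI)
    \<comment> \<open>Forgetting the copy index recovers the edge of \<open>H\<close> from its
      copy.\<close>
    have "e = snd ` Pair i ` e" by (auto simp: image_image)
    also have "\<dots> = {u, v}" using e(3)[symmetric] p q by auto
    finally have "touching (induced G (S i)) (B i u) (B i v)" using B(3) e by metis
    then have "touching G (B i u) (B i v)" unfolding touching_def edges_induced by blast
    then show "touching G (case p of (i, v) \<Rightarrow> B i v) (case q of (i, v) \<Rightarrow> B i v)"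
      by (simp add: p q)
  next
    fix p assume "p \<in> verts (copies k H)"
    then obtain i v where "p = (i, v)" "i < k" "v \<in> verts H" by (auto simp: copies_def)
    then show "connected_set G (case p of (i, v) \<Rightarrow> B i v)" using sub(1) by simp
  qed
qed

section \<open>Trees and packings\<close>

lemma is_cycle_subset_edges:
  assumes "is_cycle G c" "\<And>i. i < length c \<Longrightarrow> {c ! i, c ! (Suc i mod length c)} \<in> edges H"
  shows "is_cycle H c"
  using assms by (auto simp: is_cycle_def)

text \<open>The two neighbours are the cyclic successor and predecessor, which differ as the length
  is at least 3. Hence a vertex with one neighbour lies on no cycle.\<close>

lemma is_cycle_two_neighbours:
  assumes "is_cycle G c" "v \<in> set c"
  obtains a b where "a \<noteq> b" "{v, a} \<in> edges G" "{v, b} \<in> edges G"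
proof -
  let ?n = "length c"
  have c: "3 \<le> ?n" "distinct c" "\<And>i. i < ?n \<Longrightarrow> {c ! i, c ! (Suc i mod ?n)} \<in> edges G"
    using assms by (auto simp: is_cycle_def)
  obtain i where i: "i < ?n" "c ! i = v" using assms(2) by (auto simp: in_set_conv_nth)
  define j where "j = (if i = 0 then ?n - 1 else i - 1)"
  have j: "j < ?n" "Suc j mod ?n = i" using i by (auto simp: j_def)
  have "Suc i mod ?n < ?n" using i by (intro mod_less_divisor) linarith
  moreover have "Suc i mod ?n \<noteq> j"
    using i c(1) by (cases "Suc i = ?n") (auto simp: j_def)
  ultimately have "c ! (Suc i mod ?n) \<noteq> c ! j" using c(2) j(1) by (simp add: nth_eq_iff_index_eq)
  moreover have "{v, c ! (Suc i mod ?n)} \<in> edges G" using c(3)[OF i(1)] i(2) by simp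
  moreover have "{v, c ! j} \<in> edges G" using c(3)[OF j(1)] i(2) j(2) by (simp add: insert_commute)
  ultimately show ?thesis using that by blast
qed

lemma is_tree_singleton: "is_tree (Graph {v} {})"
  unfolding is_tree_def is_cycle_def
  by (force simp: simple_graph_def intro: connected_set_singleton)

text \<open>The new vertex \<open>b\<close> has only the neighbour \<open>a\<close>, so it lies on
  no cycle, and a cycle avoiding \<open>b\<close> is one of \<open>T\<close>.\<close>

lemma is_tree_insert:
  assumes T: "is_tree T" "a \<in> verts T" "b \<notin> verts T"
  shows "is_tree (Graph (insert b (verts T)) (insert {a, b} (edges T)))" (is "is_tree ?T")
proof -
  have simple: "simple_graph T" and conn: "connected_set T (verts T)"
    and acyc: "\<And>c. \<not> is_cycle T c"
    using T by (auto simp: is_tree_def)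
  have "a \<noteq> b" using T by auto
  then have "simple_graph ?T" using simple T by (auto simp: simple_graph_def)
  moreover have "connected_set ?T (insert b (verts T))"
  proof (rule connected_set_insert)
    have "adj T (verts T) \<subseteq> adj ?T (verts T)" by (auto simp: adj_def)
    from rtrancl_mono[OF this] show "connected_set ?T (verts T)"
      using conn unfolding connected_set_iff_adj graph.sel by blast
  qed (use T in auto)
  moreover have "\<not> is_cycle ?T c" for c
  proof
    assume c: "is_cycle ?T c"
    have only: "w = a" if "{b, w} \<in> edges ?T" for w
      using that T simple by (auto simp: doubleton_eq_iff simple_graph_def)
    have "b \<notin> set c"
    proof
      assume "b \<in> set c"
      then obtain w w' where "w \<noteq> w'" "{b, w} \<in> edges ?T" "{b, w'} \<in> edges ?T"
        using is_cycle_two_neighbours[OF c] by metis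
      then show False using only by blast
    qed
    have "is_cycle T c"
    proof (rule is_cycle_subset_edges[OF c])
      fix i assume i: "i < length c"
      then have "c ! i \<in> set c" "c ! (Suc i mod length c) \<in> set c"
        by (simp, intro nth_mem mod_less_divisor) linarith
      then have "{c ! i, c ! (Suc i mod length c)} \<noteq> {a, b}"
        using \<open>b \<notin> set c\<close> by (metis insertCI insertE singletonD)
      then show "{c ! i, c ! (Suc i mod length c)} \<in> edges T"
        using c i by (auto simp: is_cycle_def)
    qed
    then show False using acyc by blast
  qed
  ultimately show ?thesis by (simp add: is_tree_def)
qed

text \<open>The tree grows along with the connected set, one leaf per step. Its vertices are
  normalised to an initial segment so that only finitely many trees occur for a given size, which a
  later pigeonhole argument uses.\<close>

lemma connected_set_spanning_tree:
  assumes "connected_set G S" "finite S"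
  obtains T :: "nat graph" where "is_tree T" "verts T = {..<card S}" "is_minor T (induced G S)"
proof -
  let ?P = "\<lambda>X. \<exists>T f. is_tree T \<and> verts T = {..<card X} \<and> bij_betw f {..<card X} X \<and>
    (\<forall>u v. {u, v} \<in> edges T \<longrightarrow> {f u, f v} \<in> edges G)"
  have "?P S"
    using assms
  proof (rule connected_set_induct)
    fix r assume "r \<in> S"
    have "verts (Graph {0::nat} {}) = {..<card {r}}" by auto
    moreover have "bij_betw (\<lambda>_. r) {..<card {r}} {r}" by (auto simp: bij_betw_def inj_on_def)
    ultimately show "?P {r}"
      using is_tree_singleton[of "0::nat"]
      by (intro exI[of _ "Graph {0::nat} {}"] exI[of _ "\<lambda>_. r"]) simp
  next
    fix X a b
    assume X: "X \<subseteq> S" "?P X" and ab: "a \<in> X" "b \<in> S - X" "{a, b} \<in> edges G"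
    then obtain T f where T: "is_tree T" "verts T = {..<card X}" and f: "bij_betw f {..<card X} X"
      and e: "\<And>u v. {u, v} \<in> edges T \<Longrightarrow> {f u, f v} \<in> edges G" by blast
    define n where "n = card X"
    have n: "card (insert b X) = Suc n"
      using X ab assms(2) by (simp add: n_def finite_subset)
    have "a \<in> f ` {..<n}" using f ab(1) by (simp add: bij_betw_def n_def)
    then obtain i where i: "i < n" "f i = a" by auto
    \<comment> \<open>The new leaf gets the first free label \<open>n\<close>, which keeps the
      labels an initial segment.\<close>
    let ?T = "Graph (insert n (verts T)) (insert {i, n} (edges T))" and ?f = "f(n := b)"
    have "is_tree ?T"
      by (rule is_tree_insert[OF T(1)]) (use i(1) in \<open>simp_all add: T(2) n_def\<close>)
    moreover have "verts ?T = {..<Suc n}" by (simp add: T(2) lessThan_Suc n_def)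
    moreover have "bij_betw ?f {..<Suc n} (insert b X)"
    proof -
      have "bij_betw ?f {..<n} X"
        using f unfolding n_def[symmetric] by (subst bij_betw_cong[of _ _ f]) auto
      then show ?thesis using ab by (auto simp: bij_betw_def lessThan_Suc)
    qed
    moreover have "{?f u, ?f v} \<in> edges G" if "{u, v} \<in> edges ?T" for u v
    proof (cases "{u, v} = {i, n}")
      case True
      then have "u = i \<and> v = n \<or> u = n \<and> v = i" by (auto simp: doubleton_eq_iff)
      then show ?thesis using i ab by (auto simp: insert_commute)
    next
      case False
      then have "{u, v} \<in> edges T" using that by simp
      moreover then have "{u, v} \<subseteq> {..<n}"
        using T by (auto simp: is_tree_def simple_graph_def n_def)
      ultimately show ?thesis using e by auto
    qed
    ultimately show "?P (insert b X)" unfolding n by (intro exI[of _ ?T] exI[of _ ?f] conjI allI impI)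
  qed
  then obtain T f where T: "is_tree T" "verts T = {..<card S}" and f: "bij_betw f {..<card S} S"
    and e: "\<And>u v. {u, v} \<in> edges T \<Longrightarrow> {f u, f v} \<in> edges G" by blast
  have "is_minor T (induced G S)"
  proof (rule is_minor_inj[of f])
    fix u v assume uv: "{u, v} \<in> edges T"
    then have "u < card S" "v < card S" using T by (auto simp: is_tree_def simple_graph_def)
    then show "{f u, f v} \<in> edges (induced G S)"
      using e[OF uv] f by (auto simp: bij_betw_def)
  qed (use T f connected_set_subset[OF assms(1)] in \<open>auto simp: bij_betw_def\<close>)
  then show ?thesis using that T by blast
qed

text \<open>Growing \<open>S\<close> vertex by vertex, each new vertex brings at least the edge
  along which it was reached.\<close>

lemma connected_set_many_edges:
  assumes G: "simple_graph G" and S: "connected_set G S"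
  shows "card S \<le> card (edges (induced G S)) + 1"
proof -
  have "finite S" using G connected_set_subset[OF S] by (auto simp: simple_graph_def intro: finite_subset)
  with S show ?thesis
  proof (induction rule: connected_set_induct)
    case (insert X a b)
    have fin: "finite (edges (induced G (insert b X)))"
      using finite_edges[OF simple_graph_induced[OF G]] .
    have "insert {a, b} (edges (induced G X)) \<subseteq> edges (induced G (insert b X))" using insert by auto
    from card_mono[OF fin this] have "Suc (card (edges (induced G X))) \<le> card (edges (induced G (insert b X)))"
      using insert finite_edges[OF simple_graph_induced[OF G, of X]] by (subst (asm) card_insert_disjoint) auto
    moreover have "card (insert b X) = Suc (card X)" using insert finite_subset[OF _ \<open>finite S\<close>] by simp
    ultimately show ?case using insert by linarith
  qed simp_all
qed

text \<open>A new vertex with two neighbours in the connected part already built would close a cycle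
  and give a triangle minor, so each new vertex brings at most one edge.\<close>

lemma connected_set_few_edges:
  assumes G: "simple_graph G" and S: "connected_set G S"
    and no: "\<not> is_minor (complete_graph 3) (induced G S)"
  shows "card (edges (induced G S)) + 1 \<le> card S"
proof -
  have "finite S" using G connected_set_subset[OF S] by (auto simp: simple_graph_def intro: finite_subset)
  with S show ?thesis
  proof (induction rule: connected_set_induct)
    case (singleton r)
    have False if "e \<in> edges G" "e \<subseteq> {r}" for e
      using card_mono[OF _ that(2)] G that(1) by (auto simp: simple_graph_def)
    then have "edges (induced G {r}) = {}" by auto
    then show ?case by simp
  next
    case (insert X a b)
    \<comment> \<open>A second neighbour \<open>w\<close> of \<open>b\<close>, a part of \<open>X\<close> next to \<open>w\<close> containing \<open>a\<close>, and \<open>b\<close> itself would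
      be the branch sets of a triangle.\<close>
    have unique: "w = a" if "w \<in> X" "{w, b} \<in> edges G" for w
    proof (rule ccontr)
      assume "w \<noteq> a"
      then have "a \<noteq> w" by simp
      from connected_set_split[OF insert(2,3) that(1) this]
      obtain Y where Y: "Y \<subseteq> X - {w}" "a \<in> Y" "connected_set G Y" "touching G Y {w}" .
      let ?H = "induced G S"
      have b: "b \<in> verts G" "b \<in> S" using insert connected_set_subset[OF S] by auto
      have w: "w \<in> verts G" "w \<in> S" using insert that connected_set_subset[OF S] by auto
      have "b \<notin> Y" "w \<notin> Y" "w \<noteq> b" "Y \<subseteq> S" using insert Y that by auto
      have ne: "Y \<noteq> {b}" "Y \<noteq> {w}" "{b} \<noteq> {w}"
        using \<open>b \<notin> Y\<close> \<open>w \<notin> Y\<close> \<open>w \<noteq> b\<close> by auto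
      have t1: "touching ?H Y {b}" using insert Y b \<open>Y \<subseteq> S\<close> by (auto simp: touching_def)
      have t2: "touching ?H Y {w}" using Y w \<open>Y \<subseteq> S\<close> by (auto simp: touching_def)
      have t3: "touching ?H {b} {w}" using that b w by (auto simp: touching_def insert_commute)
      have "is_minor (complete_graph 3) ?H"
      proof (rule is_minor_complete_graph[of "{Y, {b}, {w}}"])
        show "card {Y, {b}, {w}} = 3" using ne by simp
        show "pairwise disjnt {Y, {b}, {w}}"
          using \<open>b \<notin> Y\<close> \<open>w \<notin> Y\<close> \<open>w \<noteq> b\<close> by (auto simp: pairwise_insert disjnt_def)
        show "connected_set ?H Z" if "Z \<in> {Y, {b}, {w}}" for Z
          using that connected_set_in_induced[OF Y(3) \<open>Y \<subseteq> S\<close>] b w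
          by (auto intro: connected_set_singleton)
        show "touching ?H Z Z'" if "Z \<in> {Y, {b}, {w}}" "Z' \<in> {Y, {b}, {w}}" "Z \<noteq> Z'" for Z Z'
          using that t1 t2 t3 touching_sym by blast
      qed simp
      then show False using no by blast
    qed
    have sub: "edges (induced G (insert b X)) \<subseteq> insert {a, b} (edges (induced G X))"
    proof
      fix e assume e: "e \<in> edges (induced G (insert b X))"
      then obtain u v where uv: "e = {u, v}" "u \<noteq> v" using simple_graph_edgeE[OF G, of e] unfolding edges_induced by blast
      show "e \<in> insert {a, b} (edges (induced G X))"
      proof (cases "b \<in> e")
        case True
        then obtain w where "e = {w, b}" "w \<noteq> b" using uv by (auto simp: insert_commute)
        then have "w = a" using unique e by auto
        then show ?thesis using \<open>e = {w, b}\<close> by simp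
      qed (use e in auto)
    qed
    have fin: "finite (edges (induced G X))"
      using finite_edges[OF simple_graph_induced[OF G]] .
    have "card (edges (induced G (insert b X))) \<le> card (insert {a, b} (edges (induced G X)))"
      by (rule card_mono[OF _ sub]) (simp only: fin finite_insert)
    also have "\<dots> \<le> Suc (card (edges (induced G X)))"
      unfolding card_insert_if[OF fin] by simp
    finally have "card (edges (induced G (insert b X))) \<le> Suc (card (edges (induced G X)))" .
    moreover have "card (insert b X) = Suc (card X)" using insert finite_subset[OF _ \<open>finite S\<close>] by simp
    ultimately show ?case using insert by linarith
  qed
qed

text \<open>Delete a largest packing of connected sets of \<open>Suc a\<close> vertices: at most
  \<open>p * Suc a\<close> vertices with \<open>d\<close> edges each. The components left have at
  most \<open>a\<close> vertices. At most \<open>q\<close> of them have a triangle minor, with at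
  most \<open>2 ^ a\<close> edges each; the others have one edge less than vertices. Multiplying by
  \<open>a\<close> keeps the count in the naturals.\<close>

lemma edges_le_of_bounded_packings:
  assumes G: "simple_graph G"
    and deg: "\<And>v. v \<in> verts G \<Longrightarrow> card {e \<in> edges G. v \<in> e} \<le> d"
    and large: "\<And>F. (\<And>S. S \<in> F \<Longrightarrow> connected_set G S \<and> card S = Suc a) \<Longrightarrow> pairwise disjnt F \<Longrightarrow>
      card F \<le> p"
    and cyclic: "\<And>F. (\<And>S. S \<in> F \<Longrightarrow> connected_set G S \<and> is_minor (complete_graph 3) (induced G S)) \<Longrightarrow>
      pairwise disjnt F \<Longrightarrow> card F \<le> q"
  shows "a * card (edges G) \<le> (a - 1) * card (verts G) + a * (p * Suc a * d + q * 2 ^ a)"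
proof -
  have finV: "finite (verts G)" using G by (simp add: simple_graph_def)
  let ?Q = "\<lambda>F. (\<forall>S\<in>F. connected_set G S \<and> card S = Suc a) \<and> pairwise disjnt F"
  have "?Q {}" "\<forall>F. ?Q F \<longrightarrow> card F < Suc p" using large by (auto simp: less_Suc_eq_le)
  from ex_has_greatest_nat[of ?Q, OF this]
  obtain F where F: "?Q F" and maxF: "\<And>F'. ?Q F' \<Longrightarrow> card F' \<le> card F" by blast
  have "F \<subseteq> Pow (verts G)" using F connected_set_subset by blast
  then have finF: "finite F" using finV by (simp add: finite_subset)
  define U where "U = \<Union>F"
  define R where "R = verts G - U"
  have "card U \<le> (\<Sum>S\<in>F. card S)" unfolding U_def using card_Union_le_sum_card by blast
  also have "\<dots> = card F * Suc a" using F by simp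
  also have "\<dots> \<le> p * Suc a" using large[of F] F by (intro mult_right_mono) auto
  finally have cardU: "card U \<le> p * Suc a" .
  have UV: "U \<subseteq> verts G" unfolding U_def using F connected_set_subset by blast
  \<comment> \<open>A larger connected set in \<open>R\<close> would contain one of exactly
    \<open>Suc a\<close> vertices, which could join the packing \<open>F\<close>.\<close>
  have small: "card S \<le> a" if S: "connected_set G S" "S \<subseteq> R" for S
  proof (rule ccontr)
    assume "\<not> card S \<le> a"
    moreover have "finite S" using S finV by (auto simp: R_def intro: finite_subset)
    ultimately have "\<exists>X\<subseteq>S. card X = Suc a \<and> connected_set G X \<and> True"
      using S(1) by (intro connected_set_grow) auto
    then obtain X where X: "X \<subseteq> S" "card X = Suc a" "connected_set G X" by blast
    have dis: "disjnt X Y" if "Y \<in> F" for Y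
      using X S that by (auto simp: disjnt_def R_def U_def)
    then have "?Q (insert X F)"
      using F X dis by (auto simp: pairwise_insert disjnt_sym)
    moreover have "X \<notin> F" using dis connected_set_nonempty[OF X(3)] by (auto simp: disjnt_def)
    ultimately show False using maxF[of "insert X F"] finF by simp
  qed
  \<comment> \<open>\<open>K\<close> is the set of components of the graph induced by
    \<open>R\<close>.\<close>
  define comp where "comp v = {w. (v, w) \<in> (adj G R)\<^sup>*}" for v
  define K where "K = comp ` R"
  have finR: "finite R" and RV: "R \<subseteq> verts G" using finV by (auto simp: R_def)
  have compR: "connected_set G c" "c \<subseteq> R" if "c \<in> K" for c
    using that reachable_connected[OF RV] by (auto simp: K_def comp_def)
  have symR: "(v, u) \<in> (adj G R)\<^sup>*" if "(u, v) \<in> (adj G R)\<^sup>*" for u v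
    using that sym_rtrancl[OF sym_adj] by (meson symD)
  have compeq: "comp u = comp v" if "(u, v) \<in> (adj G R)\<^sup>*" for u v
    unfolding comp_def using that symR[OF that] by (meson Collect_cong rtrancl_trans)
  have disK: "pairwise disjnt K"
  proof (rule pairwiseI)
    fix c c' assume "c \<in> K" "c' \<in> K" "c \<noteq> c'"
    then obtain u v where uv: "c = comp u" "c' = comp v" by (auto simp: K_def)
    show "disjnt c c'"
    proof (rule ccontr)
      assume "\<not> disjnt c c'"
      then obtain w where "(u, w) \<in> (adj G R)\<^sup>*" "(v, w) \<in> (adj G R)\<^sup>*"
        by (auto simp: disjnt_def uv comp_def)
      then show False using compeq \<open>c \<noteq> c'\<close> uv by metis
    qed
  qed
  have finK: "finite K" using finR by (simp add: K_def)
  have finc: "finite c" if "c \<in> K" for c using compR(2)[OF that] finR by (rule finite_subset)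
  define K2 where "K2 = {c \<in> K. is_minor (complete_graph 3) (induced G c)}"
  have K2: "card K2 \<le> q"
  proof (rule cyclic)
    show "pairwise disjnt K2" using disK by (rule pairwise_subset) (auto simp: K2_def)
  qed (use compR in \<open>auto simp: K2_def\<close>)
  \<comment> \<open>For a component without triangle minor, \<open>a * (card c - 1)\<close> is at
    most \<open>a * card c - card c\<close> because \<open>card c \<le> a\<close>. For the others
    every edge is one of the at most \<open>2 ^ a\<close> subsets of \<open>c\<close>.\<close>
  have each: "a * card (edges (induced G c)) \<le> (a - 1) * card c + (if c \<in> K2 then a * 2 ^ a else 0)"
    if c: "c \<in> K" for c
  proof (cases "c \<in> K2")
    case True
    have "card (edges (induced G c)) \<le> card (Pow c)"
      using finc[OF c] by (intro card_mono) auto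
    also have "\<dots> \<le> 2 ^ a" using small[OF compR[OF c]] finc[OF c] by (simp add: card_Pow)
    finally have "a * card (edges (induced G c)) \<le> a * 2 ^ a" by (rule mult_left_mono) simp
    then show ?thesis unfolding if_P[OF True] by (rule trans_le_add2)
  next
    case False
    then have "card (edges (induced G c)) + 1 \<le> card c"
      using connected_set_few_edges[OF G compR(1)[OF c]] c by (auto simp: K2_def)
    then have "a * (card (edges (induced G c)) + 1) \<le> a * card c" by (rule mult_left_mono) simp
    moreover have "card c \<le> a" using small compR c by blast
    ultimately have "a * card (edges (induced G c)) \<le> a * card c - card c" by (simp add: algebra_simps)
    then show ?thesis by (simp add: diff_mult_distrib)
  qed
  \<comment> \<open>An edge meets \<open>U\<close> or has both ends in one component of
    \<open>R\<close>.\<close>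
  have "edges G \<subseteq> (\<Union>v\<in>U. {e \<in> edges G. v \<in> e}) \<union> (\<Union>c\<in>K. edges (induced G c))" (is "_ \<subseteq> ?A \<union> ?B")
  proof
    fix e assume e: "e \<in> edges G"
    then obtain x y where xy: "e = {x, y}" "x \<in> verts G" "y \<in> verts G"
      using simple_graph_edgeE[OF G] by metis
    show "e \<in> ?A \<union> ?B"
    proof (cases "x \<in> U \<or> y \<in> U")
      case True
      then show ?thesis using e xy by auto
    next
      case False
      then have R: "x \<in> R" "y \<in> R" using xy by (auto simp: R_def)
      then have "(x, y) \<in> adj G R" using e xy by (auto simp: adj_def)
      then have "e \<subseteq> comp x" using xy by (auto simp: comp_def)
      then show ?thesis using e R by (auto simp: K_def)
    qed
  qed
  moreover have finAB: "finite ?A" "finite ?B"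
    using finite_edges[OF G] by (auto intro: finite_subset[of _ "edges G"])
  ultimately have "card (edges G) \<le> card (?A \<union> ?B)" by (intro card_mono) auto
  also have "\<dots> \<le> card ?A + card ?B" by (rule card_Un_le)
  also have "card ?A \<le> (\<Sum>v\<in>U. card {e \<in> edges G. v \<in> e})"
    by (rule card_UN_le) (use UV finV in \<open>auto intro: finite_subset\<close>)
  also have "\<dots> \<le> (\<Sum>v\<in>U. d)" using deg UV by (intro sum_mono) auto
  also have "\<dots> \<le> p * Suc a * d" using cardU by simp
  also have "card ?B \<le> (\<Sum>c\<in>K. card (edges (induced G c)))" using finK by (rule card_UN_le)
  finally have "card (edges G) \<le> p * Suc a * d + (\<Sum>c\<in>K. card (edges (induced G c)))" by simp
  then have "a * card (edges G) \<le> a * (p * Suc a * d + (\<Sum>c\<in>K. card (edges (induced G c))))"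
    by (rule mult_left_mono) simp
  also have "\<dots> = a * (p * Suc a * d) + (\<Sum>c\<in>K. a * card (edges (induced G c)))"
    by (simp add: distrib_left sum_distrib_left)
  also have "(\<Sum>c\<in>K. a * card (edges (induced G c))) \<le>
      (\<Sum>c\<in>K. (a - 1) * card c + (if c \<in> K2 then a * 2 ^ a else 0))"
    by (rule sum_mono) (rule each)
  also have "\<dots> = (a - 1) * (\<Sum>c\<in>K. card c) + card K2 * (a * 2 ^ a)"
  proof -
    have "K \<inter> K2 = K2" by (auto simp: K2_def)
    then show ?thesis
      using finK by (simp add: sum.distrib sum_distrib_left sum.If_cases)
  qed
  also have "(\<Sum>c\<in>K. card c) = card (\<Union>K)"
    using disK finc by (simp add: card_Union_disjoint)
  also have "(a - 1) * card (\<Union>K) \<le> (a - 1) * card (verts G)"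
    using compR RV finV by (intro mult_left_mono card_mono) blast+
  also have "card K2 * (a * 2 ^ a) \<le> q * (a * 2 ^ a)" using K2 by (rule mult_right_mono) simp
  finally show ?thesis by (simp add: algebra_simps)
qed

section \<open>Balanced separators\<close>

fun ball :: "'a graph \<Rightarrow> 'a set \<Rightarrow> 'a \<Rightarrow> nat \<Rightarrow> 'a set" where
  "ball G R r 0 = {r}"
| "ball G R r (Suc j) = ball G R r j \<union> {w \<in> R. \<exists>u\<in>ball G R r j. {u, w} \<in> edges G}"

lemma ball_subset: "r \<in> R \<Longrightarrow> ball G R r j \<subseteq> R"
  by (induction j) auto

lemma ball_mono: "ball G R r j \<subseteq> ball G R r (Suc j)"
  by auto

lemma centre_in_ball: "r \<in> ball G R r j"
  by (induction j) auto

text \<open>Paths are needed only as small connected sets, since they will be parts of branch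
  sets.\<close>

lemma ball_path:
  assumes "R \<subseteq> verts G" "r \<in> R" "w \<in> ball G R r j"
  obtains P where "connected_set G P" "P \<subseteq> R" "r \<in> P" "w \<in> P" "finite P" "card P \<le> Suc j"
proof -
  have "\<exists>P. connected_set G P \<and> P \<subseteq> R \<and> r \<in> P \<and> w \<in> P \<and> finite P \<and> card P \<le> Suc j"
    using assms(3)
  proof (induction j arbitrary: w)
    case 0
    then show ?case using assms by (intro exI[of _ "{r}"]) (auto intro: connected_set_singleton)
  next
    case (Suc j)
    show ?case
    proof (cases "w \<in> ball G R r j")
      case True
      then show ?thesis using Suc.IH[OF True] by (meson le_SucI)
    next
      case False
      then obtain u where u: "u \<in> ball G R r j" "{u, w} \<in> edges G" "w \<in> R" using Suc.prems by auto
      then obtain P where P: "connected_set G P" "P \<subseteq> R" "r \<in> P" "u \<in> P" "finite P" "card P \<le> Suc j"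
        using Suc.IH by meson
      have "connected_set G (insert w P)"
        using connected_set_insert[OF P(1,4) _ u(2)] u(3) assms(1) by blast
      moreover have "card (insert w P) \<le> Suc (Suc j)"
        using P by (simp add: card_insert_if)
      ultimately show ?thesis using P u by (intro exI[of _ "insert w P"]) auto
    qed
  qed
  then show ?thesis using that by blast
qed

text \<open>If every ball up to radius \<open>l * k\<close> grew by a factor above \<open>1 + 1 / l\<close>, then Bernoulli's
  inequality would give a ball with more than \<open>2 ^ k\<close> vertices.\<close>

lemma ball_small_boundary:
  assumes "finite R" "r \<in> R" "card R < 2 ^ k" "1 \<le> l"
  shows "\<exists>j\<le>l * k. l * card (ball G R r (Suc j) - ball G R r j) \<le> card (ball G R r j)"
proof (rule ccontr)
  assume none: "\<not> ?thesis"
  let ?b = "\<lambda>j. card (ball G R r j)"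
  have fin: "finite (ball G R r j)" for j using ball_subset[OF assms(2)] assms(1) by (rule finite_subset)
  have step: "(1 + 1 / real l) * real (?b j) \<le> real (?b (Suc j))" if "j \<le> l * k" for j
  proof -
    have "?b j < l * card (ball G R r (Suc j) - ball G R r j)" using none that by (meson not_le)
    also have "\<dots> = l * (?b (Suc j) - ?b j)"
      using card_Diff_subset[OF fin ball_mono] by metis
    finally have "?b j \<le> l * (?b (Suc j) - ?b j)" by simp
    moreover have "l * ?b j \<le> l * ?b (Suc j)" by (intro mult_le_mono2 card_mono fin ball_mono)
    ultimately have "?b j + l * ?b j \<le> l * ?b (Suc j)" unfolding diff_mult_distrib2 by linarith
    then have "real (?b j) + real l * real (?b j) \<le> real l * real (?b (Suc j))"
      by (metis of_nat_add of_nat_le_iff of_nat_mult)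
    then show ?thesis using assms(4) by (simp add: field_simps)
  qed
  have pow: "(1 + 1 / real l) ^ j \<le> real (?b j)" if "j \<le> l * k" for j
    using that
  proof (induction j)
    case (Suc j)
    have "(1 + 1 / real l) ^ Suc j \<le> (1 + 1 / real l) * real (?b j)"
      using Suc by (simp add: mult_left_mono)
    also have "\<dots> \<le> real (?b (Suc j))" using step Suc.prems by simp
    finally show ?case .
  qed simp
  have "(2::real) \<le> (1 + 1 / real l) ^ l"
    using Bernoulli_inequality[of "1 / real l" l] assms(4) by (simp add: order_trans[of _ 0])
  then have "(2::real) ^ k \<le> (1 + 1 / real l) ^ (l * k)"
    unfolding power_mult by (rule power_mono) simp
  also have "\<dots> \<le> real (?b (l * k))" by (rule pow) simp
  also have "\<dots> \<le> real (card R)" using card_mono[OF assms(1) ball_subset[OF assms(2)]] by simp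
  also have "\<dots> < 2 ^ k" using assms(3) by (metis of_nat_less_iff of_nat_numeral of_nat_power)
  finally show False by simp
qed

text \<open>A state of the separator search of Plotkin, Rao and Smith: \<open>D\<close> is cut off from the remaining
  vertices by the small set \<open>Z\<close> and the branch sets \<open>M\<close> of a complete minor.\<close>

definition peeling :: "'a graph \<Rightarrow> nat \<Rightarrow> nat \<Rightarrow> 'a set \<Rightarrow> 'a set \<Rightarrow> 'a set set \<Rightarrow> bool" where
  "peeling G l q D Z M \<longleftrightarrow> D \<subseteq> verts G \<and> Z \<subseteq> verts G \<and> D \<inter> \<Union>M = {} \<and>
     (\<forall>X\<in>M. connected_set G X \<and> card X \<le> q) \<and> pairwise disjnt M \<and> pairwise (touching G) M \<and>
     l * card Z \<le> card D \<and> 3 * card D \<le> 2 * card (verts G) \<and>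
     (\<forall>a\<in>D. \<forall>b\<in>verts G - (D \<union> Z \<union> \<Union>M). {a, b} \<notin> edges G)"

lemma peelingI:
  assumes "D \<subseteq> verts G" "Z \<subseteq> verts G" "D \<inter> \<Union>M = {}"
    "\<And>X. X \<in> M \<Longrightarrow> connected_set G X" "\<And>X. X \<in> M \<Longrightarrow> card X \<le> q"
    "pairwise disjnt M" "pairwise (touching G) M"
    "l * card Z \<le> card D" "3 * card D \<le> 2 * card (verts G)"
    "\<And>a b. a \<in> D \<Longrightarrow> b \<in> verts G - (D \<union> Z \<union> \<Union>M) \<Longrightarrow> {a, b} \<notin> edges G"
  shows "peeling G l q D Z M"
  unfolding peeling_def using assms by blast

text \<open>Any \<open>t\<close> members of \<open>M\<close> are disjoint, connected and pairwise
  touching, so they would be the branch sets of an excluded complete minor.\<close>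

lemma peeling_card_lt:
  assumes "simple_graph G" "\<not> is_minor (complete_graph t) G" "peeling G l q D Z M"
  shows "finite M" "card M < t"
proof -
  have "M \<subseteq> Pow (verts G)" using assms(3) connected_set_subset unfolding peeling_def by blast
  moreover have "finite (verts G)" using assms by (simp add: simple_graph_def)
  ultimately show fin: "finite M" by (simp add: finite_subset)
  show "card M < t"
  proof (rule ccontr)
    assume "\<not> card M < t"
    then obtain M' where M': "M' \<subseteq> M" "card M' = t" using obtain_subset_with_card_n by (metis not_less)
    have "is_minor (complete_graph t) G"
    proof (rule is_minor_complete_graph)
      show "finite M'" using M'(1) fin by (rule finite_subset)
      show "connected_set G X" if "X \<in> M'" for X using that M'(1) assms(3) by (auto simp: peeling_def)
      show "pairwise disjnt M'"
        by (rule pairwise_subset[OF _ M'(1)]) (use assms(3) in \<open>simp add: peeling_def\<close>)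
      have "pairwise (touching G) M'"
        by (rule pairwise_subset[OF _ M'(1)]) (use assms(3) in \<open>simp add: peeling_def\<close>)
      then show "touching G X Y" if "X \<in> M'" "Y \<in> M'" "X \<noteq> Y" for X Y
        using that by (simp add: pairwise_def)
    qed (rule M'(2))
    then show False using assms(2) by blast
  qed
qed

text \<open>Progress means that \<open>D\<close> grows, or that \<open>D\<close> stays and
  \<open>M\<close> grows. As \<open>card M < t\<close>, the weight \<open>Suc t\<close> makes any
  growth of \<open>D\<close> outweigh a loss in \<open>M\<close>. The bound \<open>q\<close> is the
  size of a new branch set: one centre and fewer than \<open>t\<close> connections, each made of two
  paths inside balls of radius at most \<open>l * k\<close>.\<close>

lemma peeling_improve:
  fixes G :: "'a graph" and k l t :: nat
  defines "q \<equiv> 1 + t * (2 * Suc (l * k))"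
  assumes G: "simple_graph G" and no: "\<not> is_minor (complete_graph t) G"
    and N: "card (verts G) < 2 ^ k" and l: "1 \<le> l"
    and st: "peeling G l q D Z M"
    and big: "2 * card (verts G) < 3 * card (verts G - (D \<union> Z \<union> \<Union>M))"
  shows "\<exists>D' Z' M'. peeling G l q D' Z' M' \<and> card D * Suc t + card M < card D' * Suc t + card M'"
proof -
  define R where "R = verts G - (D \<union> Z \<union> \<Union>M)"
  have finV: "finite (verts G)" using G by (simp add: simple_graph_def)
  have st': "D \<subseteq> verts G" "Z \<subseteq> verts G" "D \<inter> \<Union>M = {}" "\<And>X. X \<in> M \<Longrightarrow> connected_set G X"
    "\<And>X. X \<in> M \<Longrightarrow> card X \<le> q" "pairwise disjnt M" "pairwise (touching G) M"
    "l * card Z \<le> card D" "3 * card D \<le> 2 * card (verts G)"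
    "\<And>a b. a \<in> D \<Longrightarrow> b \<in> R \<Longrightarrow> {a, b} \<notin> edges G"
    using st by (auto simp: peeling_def R_def)
  have finM: "finite M" and cardM: "card M < t" using peeling_card_lt[OF G no st] by auto
  have fin: "finite D" "finite R" using finV st' by (auto simp: R_def intro: finite_subset)
  have RV: "R \<subseteq> verts G" and RD: "R \<inter> D = {}" and RM: "R \<inter> \<Union>M = {}" by (auto simp: R_def)
  have bigR: "2 * card (verts G) < 3 * card R" using big by (simp add: R_def)
  have sumDR: "card E + card R \<le> card (verts G)" if "E \<subseteq> verts G" "R \<inter> E = {}" for E
  proof -
    have "finite E" using that finV by (simp add: finite_subset)
    then have "card E + card R = card (E \<union> R)" using that fin by (subst card_Un_disjoint) auto
    also have "\<dots> \<le> card (verts G)" using that RV finV by (intro card_mono) auto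
    finally show ?thesis .
  qed
  have cardR: "card R < 2 ^ k" using card_mono[OF finV RV] N by linarith
  \<comment> \<open>A branch set without neighbours in \<open>R\<close> moves to \<open>D\<close>; a ball with small boundary that fills at most
    half of \<open>R\<close> is cut off. Otherwise any two chosen balls in \<open>R\<close> meet, so short paths through the
    intersections form a new branch set that touches all others.\<close>
  consider (loose) X where "X \<in> M" "\<not> touching G X R"
    | (cut) r j where "\<And>X. X \<in> M \<Longrightarrow> touching G X R" "r \<in> R" "j \<le> l * k"
        "l * card (ball G R r (Suc j) - ball G R r j) \<le> card (ball G R r j)"
        "2 * card (ball G R r j) \<le> card R"
    | (grow) "\<And>X. X \<in> M \<Longrightarrow> touching G X R"
        "\<And>r. r \<in> R \<Longrightarrow> \<exists>j\<le>l * k. card R < 2 * card (ball G R r j)"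
    using ball_small_boundary[OF fin(2) _ cardR l, of _ G] by (meson not_le)
  then show ?thesis
  proof cases
    case loose
    let ?D = "D \<union> X" and ?M = "M - {X}"
    have XV: "X \<subseteq> verts G" "X \<noteq> {}"
      using connected_set_subset[OF st'(4)[OF loose(1)]] connected_set_nonempty[OF st'(4)[OF loose(1)]]
      by auto
    then have "card X \<noteq> 0" "finite X" using finV by (auto simp: finite_subset)
    have "D \<inter> X = {}" using st'(3) loose by blast
    then have cardD: "card ?D = card D + card X" using fin \<open>finite X\<close> by (simp add: card_Un_disjoint)
    have "X \<union> \<Union>?M = \<Union>M" using loose by blast
    then have R': "verts G - (?D \<union> Z \<union> \<Union>?M) = R" unfolding R_def by blast
    \<comment> \<open>\<open>?D\<close> avoids \<open>R\<close>, which has more than two thirds of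
      the vertices.\<close>
    have "3 * card ?D \<le> 2 * card (verts G)"
    proof -
      have "R \<inter> ?D = {}" using RD RM loose(1) by blast
      then show ?thesis using sumDR[of ?D] st'(1) XV bigR by simp
    qed
    moreover have "{a, b} \<notin> edges G" if "a \<in> ?D" "b \<in> R" for a b
      using that st'(10) loose(2) by (auto simp: touching_def)
    moreover have "?D \<inter> \<Union>?M = {}"
      using st'(3,6) loose(1) by (auto simp: pairwise_def disjnt_def)
    moreover have "pairwise disjnt ?M" "pairwise (touching G) ?M"
      using st'(6,7) by (auto intro: pairwise_subset)
    moreover have "?D \<subseteq> verts G" "l * card Z \<le> card ?D" using st'(1,8) XV cardD by auto
    ultimately have "peeling G l q ?D Z ?M"
      using st'(2,4,5) unfolding R'[symmetric] by (intro peelingI) blast+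
    moreover have "card D * Suc t + card M < card ?D * Suc t + card ?M"
    proof -
      have "Suc t \<le> card X * Suc t" using \<open>card X \<noteq> 0\<close> by (cases "card X") auto
      then show ?thesis using cardM unfolding cardD by (simp add: algebra_simps)
    qed
    ultimately show ?thesis by blast
  next
    case cut
    let ?C = "ball G R r j" and ?S = "ball G R r (Suc j) - ball G R r j"
    let ?D = "D \<union> ?C" and ?Z = "Z \<union> ?S"
    have CR: "?C \<subseteq> R" "?S \<subseteq> R" using ball_subset[OF cut(2)] by blast+
    then have finC: "finite ?C" "finite ?S" using fin by (auto intro: finite_subset)
    have "D \<inter> ?C = {}" using CR RD by blast
    then have cardD: "card ?D = card D + card ?C" using fin finC by (simp add: card_Un_disjoint)
    have "card ?Z \<le> card Z + card ?S" by (rule card_Un_le)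
    then have "l * card ?Z \<le> l * card Z + l * card ?S"
      by (metis add_mult_distrib2 mult_le_mono2)
    then have Zs: "l * card ?Z \<le> card ?D" using st'(8) cut(4) cardD by linarith
    have R': "verts G - (?D \<union> ?Z \<union> \<Union>M) = R - ball G R r (Suc j)"
      using CR ball_mono[of G R r j] unfolding R_def by blast
    \<comment> \<open>\<open>card D\<close> is at most \<open>card (verts G) - card R\<close> and
      the ball at most half of \<open>R\<close>. Together they miss at least half of
      \<open>R\<close>, which is more than a third of all vertices.\<close>
    have "3 * card ?D \<le> 2 * card (verts G)"
      using sumDR[of D] st'(1) RD cut(5) bigR cardD by auto
    moreover have "{a, b} \<notin> edges G" if "a \<in> ?D" "b \<in> R - ball G R r (Suc j)" for a b
      using that st'(10) by auto
    moreover have "?D \<inter> \<Union>M = {}" using st'(3) CR RM by blast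
    moreover have "?D \<subseteq> verts G" "?Z \<subseteq> verts G" using st'(1,2) CR RV by blast+
    ultimately have "peeling G l q ?D ?Z M"
      using st'(4-7) Zs unfolding R'[symmetric] by (intro peelingI)
    moreover have "card D * Suc t + card M < card ?D * Suc t + card M"
    proof -
      have "?C \<noteq> {}" using centre_in_ball[of r G R j] by blast
      then have "0 < card ?C" using finC(1) by (simp add: card_gt_0_iff)
      then have "card D * Suc t < card ?D * Suc t" unfolding cardD by (intro mult_less_mono1) linarith+
      then show ?thesis by linarith
    qed
    ultimately show ?thesis by blast
  next
    case grow
    have "card R \<noteq> 0" using bigR by auto
    then obtain r0 where r0: "r0 \<in> R" by fastforce
    have meet: "\<exists>P. connected_set G P \<and> P \<subseteq> R \<and> r0 \<in> P \<and> r \<in> P \<and> finite P \<and> card P \<le> 2 * Suc (l * k)"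
      if r: "r \<in> R" for r
    proof -
      obtain i j where ij: "i \<le> l * k" "j \<le> l * k" "card R < 2 * card (ball G R r0 i)"
        "card R < 2 * card (ball G R r j)"
        using grow(2) r0 r by blast
      have sub: "ball G R r0 i \<subseteq> R" "ball G R r j \<subseteq> R" using ball_subset r0 r by metis+
      have "ball G R r0 i \<inter> ball G R r j \<noteq> {}"
      proof
        assume "ball G R r0 i \<inter> ball G R r j = {}"
        then have "card (ball G R r0 i) + card (ball G R r j) = card (ball G R r0 i \<union> ball G R r j)"
          using sub fin(2) by (metis card_Un_disjoint finite_subset)
        also have "\<dots> \<le> card R" using sub fin(2) by (intro card_mono) auto
        finally show False using ij by linarith
      qed
      then obtain w where w: "w \<in> ball G R r0 i" "w \<in> ball G R r j" by blast
      obtain P where P: "connected_set G P" "P \<subseteq> R" "r0 \<in> P" "w \<in> P" "finite P" "card P \<le> Suc i"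
        using ball_path[OF RV r0 w(1)] by blast
      obtain Q where Q: "connected_set G Q" "Q \<subseteq> R" "r \<in> Q" "w \<in> Q" "finite Q" "card Q \<le> Suc j"
        using ball_path[OF RV r w(2)] by blast
      have "connected_set G (P \<union> Q)" using connected_set_Un[OF P(1) Q(1)] P Q by blast
      moreover have "card (P \<union> Q) \<le> 2 * Suc (l * k)"
      proof -
        have "card (P \<union> Q) \<le> card P + card Q" by (rule card_Un_le)
        also have "\<dots> \<le> Suc (l * k) + Suc (l * k)" using P(6) Q(6) ij(1,2) by (intro add_mono) simp_all
        finally show ?thesis by simp
      qed
      ultimately show ?thesis using P Q by (intro exI[of _ "P \<union> Q"]) auto
    qed
    have "\<exists>P. connected_set G P \<and> P \<subseteq> R \<and> r0 \<in> P \<and> touching G X P \<and> finite P \<and> card P \<le> 2 * Suc (l * k)"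
      if X: "X \<in> M" for X
    proof -
      obtain a r where ar: "a \<in> X" "r \<in> R" "{a, r} \<in> edges G"
        using grow(1)[OF X] by (auto simp: touching_def)
      from meet[OF ar(2)] obtain P where "connected_set G P" "P \<subseteq> R" "r0 \<in> P" "r \<in> P" "finite P"
        "card P \<le> 2 * Suc (l * k)" by blast
      moreover from this ar have "touching G X P" by (auto simp: touching_def)
      ultimately show ?thesis by blast
    qed
    then have "\<forall>X\<in>M. \<exists>P. connected_set G P \<and> P \<subseteq> R \<and> r0 \<in> P \<and> touching G X P \<and> finite P \<and>
        card P \<le> 2 * Suc (l * k)" by blast
    from bchoice[OF this] obtain P where P: "\<And>X. X \<in> M \<Longrightarrow> connected_set G (P X)" "\<And>X. X \<in> M \<Longrightarrow> P X \<subseteq> R"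
      "\<And>X. X \<in> M \<Longrightarrow> r0 \<in> P X" "\<And>X. X \<in> M \<Longrightarrow> touching G X (P X)" "\<And>X. X \<in> M \<Longrightarrow> finite (P X)"
      "\<And>X. X \<in> M \<Longrightarrow> card (P X) \<le> 2 * Suc (l * k)"
      by blast
    \<comment> \<open>Inserting \<open>{r0}\<close> keeps \<open>T\<close> nonempty when
      \<open>M\<close> is empty; all paths contain \<open>r0\<close>, so the union is
      connected.\<close>
    define T where "T = \<Union>(insert {r0} (P ` M))"
    have T: "connected_set G T" unfolding T_def
    proof (rule connected_set_Union_root[of _ _ r0])
      fix S assume "S \<in> insert {r0} (P ` M)"
      then show "connected_set G S \<and> r0 \<in> S" using P r0 RV connected_set_singleton[of r0 G] by auto
    qed simp
    have TR: "T \<subseteq> R" using P r0 by (auto simp: T_def)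
    have "T = {r0} \<union> (\<Union>X\<in>M. P X)" by (auto simp: T_def)
    then have "card T \<le> 1 + card (\<Union>X\<in>M. P X)" using card_Un_le[of "{r0}"] by simp
    also have "card (\<Union>X\<in>M. P X) \<le> (\<Sum>X\<in>M. card (P X))" using finM by (rule card_UN_le)
    also have "\<dots> \<le> (\<Sum>X\<in>M. 2 * Suc (l * k))" using P(6) by (rule sum_mono)
    also have "\<dots> \<le> t * (2 * Suc (l * k))" using cardM by (simp del: mult_Suc_right)
    finally have cardT: "card T \<le> q" by (simp add: q_def)
    let ?M = "insert T M"
    have dT: "disjnt T X" "disjnt X T" "touching G T X" "touching G X T" if X: "X \<in> M" for X
    proof -
      show "disjnt T X" "disjnt X T" using TR RM X by (auto simp: disjnt_def)
      have "P X \<subseteq> T" using X by (auto simp: T_def)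
      then show "touching G X T" by (rule touching_mono[OF P(4)[OF X] order_refl])
      then show "touching G T X" by (rule touching_sym)
    qed
    have "T \<notin> M" using TR RM connected_set_nonempty[OF T] by blast
    have pw: "pairwise disjnt ?M" "pairwise (touching G) ?M"
      using st'(6,7) dT by (simp_all add: pairwise_insert)
    have "peeling G l q D Z ?M"
    proof (rule peelingI)
      show "D \<inter> \<Union>?M = {}" using st'(3) TR RD by blast
      show "{a, b} \<notin> edges G" if "a \<in> D" "b \<in> verts G - (D \<union> Z \<union> \<Union>?M)" for a b
        by (rule st'(10)[OF that(1)]) (use that(2) in \<open>simp add: R_def\<close>)
      show "connected_set G X" if "X \<in> ?M" for X
        using that T st'(4) by (cases "X = T") simp_all
      show "card X \<le> q" if "X \<in> ?M" for X
        using that cardT st'(5) by (cases "X = T") simp_all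
    qed (fact st' pw)+
    moreover have "card M < card ?M" using \<open>T \<notin> M\<close> finM by simp
    then have "card D * Suc t + card M < card D * Suc t + card ?M" by (rule add_strict_left_mono)
    ultimately show ?thesis by blast
  qed
qed

text \<open>In a state of maximal potential the rest \<open>R\<close> has at most two thirds of the
  vertices, for otherwise the state could be improved. The separator
  \<open>Z \<union> \<Union>M\<close> is small: \<open>l * card Z \<le> card D\<close> by the
  invariant, and \<open>M\<close> has fewer than \<open>t\<close> sets of bounded size.\<close>

lemma balanced_separation:
  fixes G :: "'a graph" and k l t :: nat
  assumes G: "simple_graph G" and no: "\<not> is_minor (complete_graph t) G"
    and N: "card (verts G) < 2 ^ k" and l: "1 \<le> l"
  obtains A B where "A \<union> B = verts G" "\<And>e. e \<in> edges G \<Longrightarrow> e \<subseteq> A \<or> e \<subseteq> B"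
    "3 * card A \<le> 2 * card (verts G) + 3 * card (A \<inter> B)"
    "3 * card B \<le> 2 * card (verts G) + 3 * card (A \<inter> B)"
    "l * card (A \<inter> B) \<le> card (verts G) + l * (t * (1 + t * (2 * Suc (l * k))))"
proof -
  define q where "q = 1 + t * (2 * Suc (l * k))"
  let ?V = "verts G"
  have finV: "finite ?V" using G by (simp add: simple_graph_def)
  let ?P = "\<lambda>(D, Z, M). peeling G l q D Z M" and ?\<mu> = "\<lambda>(D, Z, M). card D * Suc t + card M"
  have "?P ({}, {}, {})" by (auto simp: peeling_def)
  moreover have "\<forall>s. ?P s \<longrightarrow> ?\<mu> s < Suc (card ?V * Suc t + t)"
  proof (intro allI impI)
    fix s assume s: "?P s"
    obtain D Z M where [simp]: "s = (D, Z, M)" by (cases s)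
    have "card D \<le> card ?V" using s finV by (auto simp: peeling_def intro: card_mono)
    then have "card D * Suc t \<le> card ?V * Suc t" by (rule mult_le_mono1)
    then show "?\<mu> s < Suc (card ?V * Suc t + t)" using peeling_card_lt[OF G no, of l q D Z M] s by simp
  qed
  ultimately have "\<exists>s. ?P s \<and> (\<forall>s'. ?P s' \<longrightarrow> ?\<mu> s' \<le> ?\<mu> s)" by (rule ex_has_greatest_nat)
  then obtain D Z M where st: "peeling G l q D Z M"
    and max: "\<And>D' Z' M'. peeling G l q D' Z' M' \<Longrightarrow> card D' * Suc t + card M' \<le> card D * Suc t + card M"
    by fastforce
  define R where "R = ?V - (D \<union> Z \<union> \<Union>M)"
  have R: "3 * card R \<le> 2 * card ?V"
    using peeling_improve[OF G no N l st[unfolded q_def]] max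
    unfolding R_def q_def by (meson not_le)
  have DV: "D \<subseteq> ?V" "Z \<subseteq> ?V" "D \<inter> \<Union>M = {}" "\<Union>M \<subseteq> ?V" and Z: "l * card Z \<le> card D"
    and D: "3 * card D \<le> 2 * card ?V" and cM: "\<And>X. X \<in> M \<Longrightarrow> card X \<le> q"
    and sep: "\<And>a b. a \<in> D \<Longrightarrow> b \<in> R \<Longrightarrow> {a, b} \<notin> edges G"
    using st connected_set_subset unfolding peeling_def R_def by blast+
  have finM: "finite M" and cardM: "card M < t" using peeling_card_lt[OF G no st] by auto
  let ?X = "Z \<union> \<Union>M"
  let ?A = "D \<union> ?X" and ?B = "R \<union> ?X"
  have AB: "?A \<inter> ?B = ?X" unfolding R_def by blast
  have "card (\<Union>M) \<le> (\<Sum>X\<in>M. card X)" using card_Union_le_sum_card by blast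
  also have "\<dots> \<le> (\<Sum>X\<in>M. q)" using cM by (rule sum_mono)
  also have "\<dots> \<le> t * q" using cardM by simp
  finally have "card ?X \<le> card Z + t * q" using card_Un_le[of Z "\<Union>M"] by linarith
  then have "l * card ?X \<le> l * card Z + l * (t * q)" by (metis add_mult_distrib2 mult_le_mono2)
  also have "\<dots> \<le> card ?V + l * (t * q)" using Z card_mono[OF finV DV(1)] by linarith
  finally have X: "l * card ?X \<le> card ?V + l * (t * q)" .
  show ?thesis
  proof (rule that[of ?A ?B])
    show "?A \<union> ?B = ?V" using DV unfolding R_def by blast
    show "e \<subseteq> ?A \<or> e \<subseteq> ?B" if e: "e \<in> edges G" for e
    proof -
      obtain a b where ab: "e = {a, b}" "a \<in> ?V" "b \<in> ?V" using simple_graph_edgeE[OF G e] by metis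
      have "{a, b} \<in> edges G" "{b, a} \<in> edges G" using e ab by (auto simp: insert_commute)
      then have "\<not> (a \<in> D \<and> b \<in> R)" "\<not> (b \<in> D \<and> a \<in> R)" using sep by blast+
      then show ?thesis using ab unfolding R_def by blast
    qed
    show "3 * card ?A \<le> 2 * card ?V + 3 * card (?A \<inter> ?B)"
      unfolding AB using card_Un_le[of D ?X] D by linarith
    show "3 * card ?B \<le> 2 * card ?V + 3 * card (?A \<inter> ?B)"
      unfolding AB using card_Un_le[of R ?X] R by linarith
    show "l * card (?A \<inter> ?B) \<le> card ?V + l * (t * (1 + t * (2 * Suc (l * k))))"
      unfolding AB using X by (simp add: q_def)
  qed
qed

section \<open>Dense induced subgraphs of prescribed size\<close>

text \<open>Throwing away a least dense item repeatedly never lowers the density of the rest.\<close>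

lemma dense_subfamily:
  fixes a e :: "'i \<Rightarrow> nat"
  assumes "finite I" "\<And>i. i \<in> I \<Longrightarrow> a i \<le> r" "r \<le> m" "m \<le> sum a I + r"
  shows "\<exists>J\<subseteq>I. sum a J \<le> m \<and> sum e I * (m - r) \<le> sum e J * sum a I"
  using assms(1,2,4)
proof (induction I rule: finite_psubset_induct)
  case (psubset I)
  show ?case
  proof (cases "sum a I \<le> m")
    case True
    have "sum e I * (m - r) \<le> sum e I * sum a I" using psubset.prems(2) by (intro mult_le_mono2) linarith
    then show ?thesis using True by blast
  next
    case False
    \<comment> \<open>Some item is at most as dense as the whole family; otherwise summing the
      strict inequalities gives a contradiction.\<close>
    have "\<exists>i\<in>I. e i * sum a I \<le> a i * sum e I"
    proof (rule ccontr)
      assume "\<not> ?thesis"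
      then have "a i * sum e I < e i * sum a I" if "i \<in> I" for i using that by (meson not_le)
      moreover have "I \<noteq> {}" using False by auto
      ultimately have "(\<Sum>i\<in>I. a i * sum e I) < (\<Sum>i\<in>I. e i * sum a I)"
        using psubset.hyps by (intro sum_strict_mono) auto
      then show False by (simp flip: sum_distrib_right add: mult.commute)
    qed
    then obtain i where i: "i \<in> I" "e i * sum a I \<le> a i * sum e I" by blast
    let ?I = "I - {i}"
    have a: "sum a I = a i + sum a ?I" and e: "sum e I = e i + sum e ?I"
      using psubset.hyps i(1) by (auto intro: sum.remove)
    have "a i \<le> r" using psubset.prems(1) i(1) by blast
    \<comment> \<open>The total exceeds \<open>m\<close> and the dropped item has size at most
      \<open>r\<close>, so the total stays above \<open>m - r\<close>, as the induction
      requires.\<close>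
    then have pos: "0 < sum a ?I" and le: "m \<le> sum a ?I + r" using False a assms(3) by linarith+
    obtain J where J: "J \<subseteq> ?I" "sum a J \<le> m" "sum e ?I * (m - r) \<le> sum e J * sum a ?I"
      using psubset.IH[of ?I] i(1) psubset.prems(1) le by blast
    have "sum e I * sum a ?I \<le> sum e ?I * sum a I"
      using i(2) unfolding a e by (simp add: algebra_simps)
    then have "(sum e I * sum a ?I) * (m - r) \<le> (sum e ?I * sum a I) * (m - r)" by (rule mult_le_mono1)
    also have "\<dots> = (sum e ?I * (m - r)) * sum a I" by (simp add: mult_ac)
    also have "\<dots> \<le> (sum e J * sum a ?I) * sum a I" using J(3) by (rule mult_le_mono1)
    finally have "sum a ?I * (sum e I * (m - r)) \<le> sum a ?I * (sum e J * sum a I)" by (simp add: mult_ac)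
    then have "sum e I * (m - r) \<le> sum e J * sum a I" using pos by simp
    then show ?thesis using J by blast
  qed
qed

text \<open>The separator bound of \<open>balanced_separation\<close> relative to the number of
  vertices, for \<open>k = i + 2\<close> and \<open>l = k ^ 2\<close>: the first term is
  \<open>1 / l\<close>, the second the additive constant divided by a vertex number of at least
  \<open>(4 / 3) ^ i\<close>.\<close>

definition separator_loss :: "nat \<Rightarrow> nat \<Rightarrow> real" where
  "separator_loss t i = 1 / real (i + 2) ^ 2 +
     real (t * (1 + t * (2 * Suc ((i + 2) ^ 3)))) * (3 / 4) ^ i"

lemma separator_loss_nonneg: "0 \<le> separator_loss t i"
  by (simp add: separator_loss_def)

text \<open>The reciprocal squares are compared with a telescoping series; the rest is a cubic
  polynomial times a geometric sequence.\<close>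

lemma summable_separator_loss: "summable (separator_loss t)"
proof -
  have sq: "summable (\<lambda>i. 1 / real (i + 2) ^ 2)"
  proof (rule summable_comparison_test')
    have "(\<lambda>i. 1 / real (Suc i)) \<longlonglongrightarrow> 0"
      using LIMSEQ_inverse_real_of_nat by (simp add: inverse_eq_divide)
    then show "summable (\<lambda>i. 1 / real (Suc i) - 1 / real (Suc (Suc i)))"
      by (rule telescope_summable')
    show "norm (1 / real (i + 2) ^ 2) \<le> 1 / real (Suc i) - 1 / real (Suc (Suc i))" if "0 \<le> i" for i
    proof -
      have "norm (1 / real (i + 2) ^ 2) = 1 / (real (Suc (Suc i)) * real (Suc (Suc i)))"
        by (simp add: power2_eq_square)
      also have "\<dots> \<le> 1 / (real (Suc i) * real (Suc (Suc i)))"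
        by (intro divide_left_mono mult_right_mono) auto
      also have "\<dots> = 1 / real (Suc i) - 1 / real (Suc (Suc i))"
        by (simp add: field_simps)
      finally show ?thesis .
    qed
  qed
  have "summable (\<lambda>i. real (i + 2) ^ 3 * (3 / 4) ^ i)"
  proof (rule summable_ratio_test)
    \<comment> \<open>From 15 on, \<open>i + 3\<close> is at most \<open>18 / 17\<close> times
      \<open>i + 2\<close>, and \<open>(18 / 17) ^ 3 * (3 / 4)\<close> is below
      \<open>9 / 10\<close>.\<close>
    fix i :: nat assume "15 \<le> i"
    have "real (Suc i + 2) \<le> (18 / 17) * real (i + 2)" using \<open>15 \<le> i\<close> by simp
    then have "real (Suc i + 2) ^ 3 \<le> ((18 / 17) * real (i + 2)) ^ 3" by (rule power_mono) simp
    then have "real (Suc i + 2) ^ 3 * (3 / 4) ^ Suc i \<le> ((18 / 17) * real (i + 2)) ^ 3 * (3 / 4) ^ Suc i"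
      by (rule mult_right_mono) simp
    also have "\<dots> = ((18 / 17) ^ 3 * (3 / 4)) * (real (i + 2) ^ 3 * (3 / 4) ^ i)"
      by (simp only: power_mult_distrib power_Suc mult_ac)
    also have "\<dots> \<le> (9 / 10) * (real (i + 2) ^ 3 * (3 / 4) ^ i)"
      by (rule mult_right_mono) (simp_all add: power3_eq_cube)
    finally show "norm (real (Suc i + 2) ^ 3 * (3 / 4) ^ Suc i) \<le>
        (9 / 10) * norm (real (i + 2) ^ 3 * (3 / 4) ^ i)" by simp
  qed simp
  moreover have "summable (\<lambda>i. (3 / 4 :: real) ^ i)" by (rule summable_geometric) simp
  ultimately have "summable (\<lambda>i. (real t + 2 * real t ^ 2) * (3 / 4) ^ i +
      2 * real t ^ 2 * (real (i + 2) ^ 3 * (3 / 4) ^ i))"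
    by (intro summable_add summable_mult)
  also have "(\<lambda>i. (real t + 2 * real t ^ 2) * (3 / 4) ^ i + 2 * real t ^ 2 * (real (i + 2) ^ 3 * (3 / 4) ^ i)) =
      (\<lambda>i. real (t * (1 + t * (2 * Suc ((i + 2) ^ 3)))) * (3 / 4) ^ i)"
    by (rule ext) (simp add: algebra_simps power2_eq_square)
  finally have "summable (\<lambda>i. real (t * (1 + t * (2 * Suc ((i + 2) ^ 3)))) * (3 / 4) ^ i)" .
  from summable_add[OF sq this] show ?thesis unfolding separator_loss_def .
qed

text \<open>Splitting a graph of at most \<open>2 ^ K * (4 / 3) ^ Suc j\<close> vertices along a balanced separator
  leaves two graphs of at most \<open>2 ^ K * (4 / 3) ^ j\<close> vertices and repeats only a fraction
  \<open>separator_loss t (K + j)\<close> of the vertices.\<close>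

lemma decomposition_aux:
  assumes small: "\<And>i. K \<le> i \<Longrightarrow> separator_loss t i \<le> 1 / 12"
    and "simple_graph G" "\<not> is_minor (complete_graph t) G"
    and "real (card (verts G)) \<le> 2 ^ K * (4 / 3) ^ j"
  shows "\<exists>Us. (\<forall>U\<in>set Us. card U \<le> 2 ^ K) \<and> \<Union>(set Us) = verts G \<and>
    (\<forall>e\<in>edges G. \<exists>U\<in>set Us. e \<subseteq> U) \<and>
    real (sum_list (map card Us)) \<le> real (card (verts G)) * exp (\<Sum>i<j. separator_loss t (K + i))"
  using assms(2-4)
proof (induction j arbitrary: G)
  case 0
  have "real (card (verts G)) \<le> real (2 ^ K)" using 0 by simp
  then have "card (verts G) \<le> 2 ^ K" by (simp only: of_nat_le_iff)
  then show ?case using 0 by (intro exI[of _ "[verts G]"]) (auto simp: simple_graph_def)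
next
  case (Suc j)
  define S where "S j = (\<Sum>i<j. separator_loss t (K + i))" for j
  have S_Suc: "S (Suc j) = S j + separator_loss t (K + j)" by (simp add: S_def)
  let ?N = "card (verts G)"
  have finV: "finite (verts G)" using Suc.prems by (simp add: simple_graph_def)
  show ?case
  proof (cases "real ?N \<le> 2 ^ K * (4 / 3) ^ j")
    case True
    have "real ?N * exp (S j) \<le> real ?N * exp (S (Suc j))"
      using separator_loss_nonneg by (intro mult_left_mono) (auto simp: S_Suc)
    then show ?thesis using Suc.IH[OF Suc.prems(1,2) True] unfolding S_def by (meson order_trans)
  next
    case False
    \<comment> \<open>This \<open>k\<close> satisfies \<open>card (verts G) < 2 ^ k\<close>, as
      \<open>4 / 3 \<le> 2\<close>; the separation is taken with \<open>l = k ^ 2\<close>.\<close>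
    define k where "k = K + j + 2"
    define C where "C = t * (1 + t * (2 * Suc (k ^ 3)))"
    let ?c = "separator_loss t (K + j)"
    have c: "?c = 1 / real (k ^ 2) + real C * (3 / 4) ^ (K + j)"
      by (simp add: separator_loss_def k_def C_def)
    have "(4 / 3 :: real) ^ Suc j \<le> 2 ^ Suc j" by (rule power_mono) auto
    then have "2 ^ K * (4 / 3 :: real) ^ Suc j \<le> 2 ^ K * 2 ^ Suc j" by (rule mult_left_mono) simp
    also have "\<dots> < 2 ^ k" by (simp add: k_def power_add)
    finally have "real ?N < 2 ^ k" using Suc.prems(3) by (rule le_less_trans[rotated])
    then have Nk: "?N < 2 ^ k" by (metis of_nat_less_iff of_nat_numeral of_nat_power)
    have "1 \<le> k ^ 2" by (simp add: k_def)
    from balanced_separation[OF Suc.prems(1,2) Nk this]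
    obtain A B where AB: "A \<union> B = verts G" "\<And>e. e \<in> edges G \<Longrightarrow> e \<subseteq> A \<or> e \<subseteq> B"
      and A: "3 * card A \<le> 2 * ?N + 3 * card (A \<inter> B)" and B: "3 * card B \<le> 2 * ?N + 3 * card (A \<inter> B)"
      and s: "k ^ 2 * card (A \<inter> B) \<le> ?N + k ^ 2 * (t * (1 + t * (2 * Suc (k ^ 2 * k))))"
      by metis
    have fin: "finite A" "finite B" using AB(1) finV by (metis finite_Un)+
    let ?s = "card (A \<inter> B)"
    have "k ^ 2 * ?s \<le> ?N + k ^ 2 * C" using s by (simp add: C_def power3_eq_cube power2_eq_square)
    then have "real (k ^ 2) * real ?s \<le> real ?N + real (k ^ 2) * real C"
      by (metis of_nat_add of_nat_le_iff of_nat_mult)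
    moreover have "0 < real (k ^ 2)" by (simp add: k_def)
    ultimately have s1: "real ?s \<le> real ?N * (1 / real (k ^ 2)) + real C"
      by (simp add: field_simps)
    \<comment> \<open>In this case the graph has at least \<open>(4 / 3) ^ (K + j)\<close> vertices,
      which turns the additive constant \<open>C\<close> into a small fraction of them.\<close>
    have "(4 / 3 :: real) ^ K \<le> 2 ^ K" by (rule power_mono) auto
    then have "(4 / 3 :: real) ^ (K + j) \<le> 2 ^ K * (4 / 3) ^ j" unfolding power_add by (rule mult_right_mono) simp
    also have "\<dots> \<le> real ?N" using False by simp
    finally have "(3 / 4) ^ (K + j) * (4 / 3 :: real) ^ (K + j) \<le> (3 / 4) ^ (K + j) * real ?N"
      by (rule mult_left_mono) simp
    then have "1 \<le> (3 / 4) ^ (K + j) * real ?N" by (simp flip: power_mult_distrib)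
    then have "real C * 1 \<le> real C * ((3 / 4) ^ (K + j) * real ?N)" by (rule mult_left_mono) simp
    then have s2: "real ?s \<le> real ?N * ?c" using s1 unfolding c by (simp add: algebra_simps)
    \<comment> \<open>With a separator of at most a twelfth, each side has at most
      \<open>2 / 3 + 1 / 12 = 3 / 4\<close> of the vertices and so drops to level
      \<open>j\<close>.\<close>
    also have "\<dots> \<le> real ?N * (1 / 12)" using small[of "K + j"] by (intro mult_left_mono) auto
    finally have s12: "12 * real ?s \<le> real ?N" by simp
    have up: "real ?N \<le> (4 / 3) * (2 ^ K * (4 / 3) ^ j)" using Suc.prems(3) by simp
    have "real (3 * card A) \<le> real (2 * ?N + 3 * ?s)" "real (3 * card B) \<le> real (2 * ?N + 3 * ?s)"
      using A B by (simp_all only: of_nat_le_iff)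
    then have cards: "real (card A) \<le> 2 ^ K * (4 / 3) ^ j" "real (card B) \<le> 2 ^ K * (4 / 3) ^ j"
      using s12 up by simp_all
    have vA: "verts (induced G A) = A" and vB: "verts (induced G B) = B" using AB(1) by auto
    have sub: "simple_graph (induced G X)" "\<not> is_minor (complete_graph t) (induced G X)" for X
      using Suc.prems(1,2) simple_graph_induced is_minor_trans[OF _ is_minor_induced] by blast+
    obtain Us where Us: "\<forall>U\<in>set Us. card U \<le> 2 ^ K" "\<Union>(set Us) = A"
      "\<forall>e\<in>edges (induced G A). \<exists>U\<in>set Us. e \<subseteq> U"
      "real (sum_list (map card Us)) \<le> real (card A) * exp (S j)"
      using Suc.IH[OF sub, of A, unfolded vA, OF cards(1)] unfolding S_def by blast
    obtain Ws where Ws: "\<forall>U\<in>set Ws. card U \<le> 2 ^ K" "\<Union>(set Ws) = B"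
      "\<forall>e\<in>edges (induced G B). \<exists>U\<in>set Ws. e \<subseteq> U"
      "real (sum_list (map card Ws)) \<le> real (card B) * exp (S j)"
      using Suc.IH[OF sub, of B, unfolded vB, OF cards(2)] unfolding S_def by blast
    have "real (sum_list (map card (Us @ Ws))) \<le> (real (card A) + real (card B)) * exp (S j)"
      using Us(4) Ws(4) by (simp add: distrib_right)
    also have "real (card A) + real (card B) = real ?N + real ?s"
      using card_Un_Int[OF fin] AB(1) by (simp flip: of_nat_add)
    also have "(real ?N + real ?s) * exp (S j) \<le> (real ?N * (1 + ?c)) * exp (S j)"
      using s2 by (intro mult_right_mono) (simp_all add: distrib_left)
    \<comment> \<open>Replacing \<open>1 + c\<close> by \<open>exp c\<close> turns the product of
      the growth factors over all levels into a sum of losses.\<close>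
    also have "\<dots> \<le> (real ?N * exp ?c) * exp (S j)"
      by (intro mult_right_mono mult_left_mono exp_ge_add_one_self) auto
    also have "\<dots> = real ?N * exp (S (Suc j))" by (simp add: S_Suc exp_add)
    finally have "real (sum_list (map card (Us @ Ws))) \<le> real ?N * exp (S (Suc j))" .
    moreover have "\<exists>U\<in>set (Us @ Ws). e \<subseteq> U" if e: "e \<in> edges G" for e
    proof -
      consider "e \<in> edges (induced G A)" | "e \<in> edges (induced G B)" using AB(2)[OF e] e by auto
      then show ?thesis using Us(3) Ws(3) unfolding set_append by cases blast+
    qed
    moreover have "card U \<le> 2 ^ K" if "U \<in> set (Us @ Ws)" for U
      using Us(1) Ws(1) that unfolding set_append by blast
    moreover have "\<Union>(set (Us @ Ws)) = verts G" by (simp only: set_append Union_Un_distrib Us(2) Ws(2) AB(1))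
    ultimately show ?thesis unfolding S_def by (intro exI[of _ "Us @ Ws"] conjI ballI)
  qed
qed

text \<open>Start at a level \<open>K\<close> beyond which the losses sum to less than
  \<open>ln (1 + \<eta>)\<close>. The total growth is then below \<open>1 + \<eta>\<close> whatever
  the depth \<open>j\<close>, and the piece size \<open>2 ^ K\<close> does not depend on the
  graph.\<close>

lemma exists_decomposition:
  fixes \<eta> :: real
  assumes "0 < \<eta>"
  shows "\<exists>r. \<forall>G :: 'a graph. simple_graph G \<longrightarrow> \<not> is_minor (complete_graph t) G \<longrightarrow>
    (\<exists>Us. (\<forall>U\<in>set Us. card U \<le> r) \<and> \<Union>(set Us) = verts G \<and>
      (\<forall>e\<in>edges G. \<exists>U\<in>set Us. e \<subseteq> U) \<and>
      real (sum_list (map card Us)) \<le> real (card (verts G)) * (1 + \<eta>))"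
proof -
  let ?c = "separator_loss t"
  have pos: "0 < ln (1 + \<eta>)" using assms by simp
  have "\<exists>K0. \<forall>K\<ge>K0. norm (\<Sum>i. ?c (i + K)) < ln (1 + \<eta>)"
    using suminf_exist_split[OF pos summable_separator_loss] .
  then have "\<forall>\<^sub>F K in sequentially. (\<Sum>i. ?c (i + K)) < ln (1 + \<eta>)"
    unfolding eventually_sequentially by (metis abs_less_iff real_norm_def)
  moreover have "\<forall>\<^sub>F i in sequentially. ?c i < 1 / 12"
    using summable_LIMSEQ_zero[OF summable_separator_loss] by (rule order_tendstoD(2)) simp
  then have "\<forall>\<^sub>F K in sequentially. \<forall>i\<ge>K. ?c i < 1 / 12" by (rule eventually_all_ge_at_top)
  ultimately have "\<forall>\<^sub>F K in sequentially. (\<Sum>i. ?c (i + K)) < ln (1 + \<eta>) \<and> (\<forall>i\<ge>K. ?c i < 1 / 12)"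
    by (rule eventually_conj)
  from eventually_happens'[OF sequentially_bot this]
  obtain K where K: "(\<Sum>i. ?c (i + K)) < ln (1 + \<eta>)" and "\<forall>i\<ge>K. ?c i < 1 / 12" by blast
  then have small: "?c i \<le> 1 / 12" if "K \<le> i" for i using that by (simp add: less_imp_le)
  show ?thesis
  proof (intro exI[of _ "2 ^ K"] allI impI)
    fix G :: "'a graph" assume G: "simple_graph G" "\<not> is_minor (complete_graph t) G"
    obtain j where "real (card (verts G)) < (4 / 3) ^ j"
      using real_arch_pow[of "4 / 3" "real (card (verts G))"] by auto
    also have "(4 / 3 :: real) ^ j \<le> 2 ^ K * (4 / 3) ^ j" by (simp add: one_le_power)
    finally have j: "real (card (verts G)) \<le> 2 ^ K * (4 / 3) ^ j" by simp
    have "(\<Sum>i<j. ?c (K + i)) \<le> (\<Sum>i. ?c (i + K))"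
      unfolding add.commute[of K]
      by (rule sum_le_suminf) (simp_all add: summable_separator_loss separator_loss_nonneg summable_ignore_initial_segment)
    then have "exp (\<Sum>i<j. ?c (K + i)) \<le> exp (ln (1 + \<eta>))" using K by simp
    also have "\<dots> = 1 + \<eta>" using assms by simp
    finally have "real (card (verts G)) * exp (\<Sum>i<j. ?c (K + i)) \<le> real (card (verts G)) * (1 + \<eta>)"
      by (rule mult_left_mono) simp
    then show "\<exists>Us. (\<forall>U\<in>set Us. card U \<le> 2 ^ K) \<and> \<Union>(set Us) = verts G \<and>
      (\<forall>e\<in>edges G. \<exists>U\<in>set Us. e \<subseteq> U) \<and>
      real (sum_list (map card Us)) \<le> real (card (verts G)) * (1 + \<eta>)"
      using decomposition_aux[OF small G j] by (meson order_trans)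
  qed
qed

text \<open>The pieces of the decomposition are the items of \<open>dense_subfamily\<close>,
  weighted by their sizes and by the edges assigned to them. The chosen pieces are padded to exactly
  \<open>m\<close> vertices.\<close>

lemma exists_dense_induced:
  fixes \<eta> :: real
  assumes "0 < \<eta>"
  shows "\<exists>r. \<forall>(G :: 'a graph) m. simple_graph G \<longrightarrow> \<not> is_minor (complete_graph t) G \<longrightarrow>
    r \<le> m \<longrightarrow> m \<le> card (verts G) \<longrightarrow> (\<exists>X\<subseteq>verts G. card X = m \<and>
      real (card (edges G)) * real (m - r) \<le>
        real (card (edges (induced G X))) * (real (card (verts G)) * (1 + \<eta>)))"
proof -
  obtain r where r: "\<And>G :: 'a graph. simple_graph G \<Longrightarrow> \<not> is_minor (complete_graph t) G \<Longrightarrow>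
    \<exists>Us. (\<forall>U\<in>set Us. card U \<le> r) \<and> \<Union>(set Us) = verts G \<and>
      (\<forall>e\<in>edges G. \<exists>U\<in>set Us. e \<subseteq> U) \<and>
      real (sum_list (map card Us)) \<le> real (card (verts G)) * (1 + \<eta>)"
    using exists_decomposition[OF assms, where t = t and 'a = 'a] by blast
  show ?thesis
  proof (intro exI[of _ r] allI impI)
    fix G :: "'a graph" and m
    assume G: "simple_graph G" "\<not> is_minor (complete_graph t) G" and m: "r \<le> m" "m \<le> card (verts G)"
    have finV: "finite (verts G)" using G(1) by (simp add: simple_graph_def)
    from r[OF G] obtain Us where Us: "\<forall>U\<in>set Us. card U \<le> r" "\<Union>(set Us) = verts G"
      "\<forall>e\<in>edges G. \<exists>U\<in>set Us. e \<subseteq> U"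
      "real (sum_list (map card Us)) \<le> real (card (verts G)) * (1 + \<eta>)"
      by (elim exE conjE)
    define I where "I = {..<length Us}"
    define a where "a i = card (Us ! i)" for i
    \<comment> \<open>Each edge is charged to the first piece that contains it, so overlaps are not
      counted twice.\<close>
    define idx where "idx e = (LEAST i. i < length Us \<and> e \<subseteq> Us ! i)" for e
    define E where "E i = {e \<in> edges G. idx e = i}" for i
    have idx: "idx e < length Us" "e \<subseteq> Us ! idx e" if "e \<in> edges G" for e
    proof -
      have "\<exists>i. i < length Us \<and> e \<subseteq> Us ! i" using bspec[OF Us(3) that] by (auto simp: in_set_conv_nth)
      then have "idx e < length Us \<and> e \<subseteq> Us ! idx e" unfolding idx_def by (rule LeastI_ex)
      then show "idx e < length Us" "e \<subseteq> Us ! idx e" by auto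
    qed
    have finE: "finite (E i)" for i using finite_edges[OF G(1)] by (simp add: E_def)
    have disE: "E i \<inter> E j = {}" if "i \<noteq> j" for i j using that by (auto simp: E_def)
    have sumE: "(\<Sum>i\<in>J. card (E i)) = card (\<Union>i\<in>J. E i)" if "J \<subseteq> I" for J
      using that finE disE by (intro card_UN_disjoint[symmetric]) (auto simp: I_def intro: finite_subset)
    have "(\<Union>i\<in>I. E i) = edges G" using idx by (auto simp: E_def I_def)
    then have W: "(\<Sum>i\<in>I. card (E i)) = card (edges G)" using sumE[of I] by simp
    have A: "(\<Sum>i\<in>I. a i) = sum_list (map card Us)"
      by (simp add: a_def I_def sum_list_sum_nth atLeast0LessThan)
    have Un: "(\<Union>i\<in>I. Us ! i) = verts G"
    proof -
      have "(!) Us ` I = set Us" by (auto simp: I_def in_set_conv_nth)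
      then show ?thesis using Us(2) by simp
    qed
    have finU: "finite (Us ! i)" if "i \<in> I" for i
      using Un that finV by (metis UN_upper finite_subset)
    have "card (verts G) \<le> (\<Sum>i\<in>I. a i)"
      unfolding Un[symmetric] a_def by (rule card_UN_le) (simp add: I_def)
    then have "m \<le> sum a I + r" using m by linarith
    then obtain J where J: "J \<subseteq> I" "sum a J \<le> m"
      "(\<Sum>i\<in>I. card (E i)) * (m - r) \<le> (\<Sum>i\<in>J. card (E i)) * sum a I"
      using dense_subfamily[of I a r m "\<lambda>i. card (E i)"] Us(1) m(1) by (auto simp: I_def a_def)
    have finJ: "finite J" using J(1) by (auto simp: I_def intro: finite_subset)
    let ?Y = "\<Union>i\<in>J. Us ! i"
    have "card ?Y \<le> m" using card_UN_le[OF finJ, of "\<lambda>i. Us ! i"] J(2) by (simp add: a_def)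
    moreover have YV: "?Y \<subseteq> verts G" using Un J(1) by blast
    \<comment> \<open>Padding with arbitrary vertices loses no edge of the chosen pieces.\<close>
    ultimately obtain X where X: "?Y \<subseteq> X" "X \<subseteq> verts G" "card X = m"
      using exists_subset_between[of ?Y m "verts G"] m(2) finV by blast
    have "(\<Union>i\<in>J. E i) \<subseteq> edges (induced G X)"
    proof
      fix e assume "e \<in> (\<Union>i\<in>J. E i)"
      then have "e \<in> edges G" "idx e \<in> J" by (auto simp: E_def)
      then show "e \<in> edges (induced G X)" using idx(2) X(1) by fastforce
    qed
    then have "(\<Sum>i\<in>J. card (E i)) \<le> card (edges (induced G X))"
      unfolding sumE[OF J(1)] using finite_edges[OF simple_graph_induced[OF G(1)]] by (intro card_mono)
    then have "card (edges G) * (m - r) \<le> card (edges (induced G X)) * sum a I"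
      using J(3) unfolding W by (meson le_trans mult_le_mono1)
    then have "real (card (edges G)) * real (m - r) \<le> real (card (edges (induced G X))) * real (sum a I)"
      by (metis of_nat_le_iff of_nat_mult)
    also have "\<dots> \<le> real (card (edges (induced G X))) * (real (card (verts G)) * (1 + \<eta>))"
      using Us(4) unfolding A by (rule mult_left_mono) simp
    finally show "\<exists>X\<subseteq>verts G. card X = m \<and> real (card (edges G)) * real (m - r) \<le>
        real (card (edges (induced G X))) * (real (card (verts G)) * (1 + \<eta>))"
      using X by blast
  qed
qed

text \<open>The suprema of the tails decrease and are nonnegative, hence converge;
  quasi-monotonicity forces each late term close to the supremum of its tail.\<close>

lemma convergent_quasi_decreasing:
  fixes a :: "nat \<Rightarrow> real"
  assumes nonneg: "\<And>n. 0 \<le> a n"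
    and quasi: "\<And>\<epsilon>. 0 < \<epsilon> \<Longrightarrow> \<exists>n0. \<forall>m\<ge>n0. \<forall>n\<ge>m. (1 - \<epsilon>) * a n \<le> a m"
  shows "convergent a"
proof -
  \<comment> \<open>The instance 1/2 bounds all terms from \<open>n0\<close> on by twice
    \<open>a n0\<close>, so the suprema exist when the tails start there.\<close>
  obtain n0 where n0: "\<And>m n. n0 \<le> m \<Longrightarrow> m \<le> n \<Longrightarrow> (1 - 1 / 2) * a n \<le> a m"
    using quasi[of "1 / 2"] by auto
  define b where "b = 2 * a n0"
  have b: "a n \<le> b" if "n0 \<le> n" for n using n0[OF order_refl that] by (simp add: b_def)
  have "0 \<le> b" using nonneg by (simp add: b_def)
  define s where "s m = Sup (a ` {m + n0..})" for m
  have bdd: "bdd_above (a ` {m + n0..})" for m using b by (intro bdd_aboveI2[of _ _ b]) auto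
  have upper: "a n \<le> s m" if "m + n0 \<le> n" for m n
    unfolding s_def using that bdd by (intro cSup_upper) auto
  have "decseq s"
    unfolding s_def by (intro decseq_SucI cSup_subset_mono bdd) auto
  moreover have "0 \<le> s m" for m using upper[OF order_refl] nonneg order_trans by blast
  ultimately obtain L where L: "s \<longlonglongrightarrow> L" using decseq_convergent by blast
  have "(\<lambda>m. s m - a (m + n0)) \<longlonglongrightarrow> 0"
  proof (rule LIMSEQ_I)
    fix \<epsilon> :: real assume "0 < \<epsilon>"
    \<comment> \<open>Chosen to make the error \<open>\<epsilon>' * b\<close> smaller than
      \<open>\<epsilon>\<close>; adding 1 covers \<open>b = 0\<close>.\<close>
    define \<epsilon>' where "\<epsilon>' = \<epsilon> / (2 * (b + 1))"
    have "0 < \<epsilon>'" using \<open>0 < \<epsilon>\<close> \<open>0 \<le> b\<close> by (simp add: \<epsilon>'_def)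
    then obtain n1 where n1: "\<And>m n. n1 \<le> m \<Longrightarrow> m \<le> n \<Longrightarrow> (1 - \<epsilon>') * a n \<le> a m"
      using quasi by metis
    have "\<epsilon>' * b < \<epsilon>" using \<open>0 < \<epsilon>\<close> \<open>0 \<le> b\<close> by (simp add: \<epsilon>'_def field_simps add_nonneg_pos)
    have "norm (s m - a (m + n0) - 0) < \<epsilon>" if "n1 \<le> m" for m
    proof -
      have "a n \<le> a (m + n0) + \<epsilon>' * b" if "m + n0 \<le> n" for n
      proof -
        have "(1 - \<epsilon>') * a n \<le> a (m + n0)" using n1 \<open>n1 \<le> m\<close> that by simp
        moreover have "\<epsilon>' * a n \<le> \<epsilon>' * b" using b that \<open>0 < \<epsilon>'\<close> by (intro mult_left_mono) auto
        ultimately show ?thesis by (simp add: algebra_simps)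
      qed
      then have "s m \<le> a (m + n0) + \<epsilon>' * b" unfolding s_def by (intro cSup_least) auto
      then show ?thesis using upper[of m "m + n0"] \<open>\<epsilon>' * b < \<epsilon>\<close> by simp
    qed
    then show "\<exists>no. \<forall>n\<ge>no. norm (s n - a (n + n0) - 0) < \<epsilon>" by blast
  qed
  from tendsto_diff[OF L this] have "(\<lambda>m. a (m + n0)) \<longlonglongrightarrow> L" by simp
  from LIMSEQ_offset[OF this] show ?thesis by (rule convergentI)
qed

section \<open>Existence of the limiting density\<close>

lemma minor_closedD:
  assumes "minor_closed \<G>" "G \<in> \<G>"
  shows "simple_graph G" "simple_graph H \<Longrightarrow> is_minor H G \<Longrightarrow> H \<in> \<G>"
  using assms unfolding minor_closed_def by blast+

lemma minor_closed_induced: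
  assumes "minor_closed \<G>" "G \<in> \<G>" shows "induced G X \<in> \<G>"
  by (rule minor_closedD(2)[OF assms simple_graph_induced is_minor_induced]) (rule minor_closedD(1)[OF assms])

text \<open>The set under \<open>Max\<close> is finite, since edges are sets of vertices, and
  \<open>G\<close> makes it nonempty; so the maximum is an upper bound and is attained.\<close>

lemma card_edges_le_ex:
  assumes "minor_closed \<G>" "G \<in> \<G>"
  shows "card (edges G) \<le> ex \<G> (card (verts G))"
  and "\<exists>H\<in>\<G>. card (verts H) = card (verts G) \<and> card (edges H) = ex \<G> (card (verts G))"
proof -
  let ?n = "card (verts G)"
  let ?A = "{card (edges G) |G. G \<in> \<G> \<and> card (verts G) = ?n}"
  have "?A \<subseteq> {..2 ^ ?n}"
  proof
    fix k assume "k \<in> ?A"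
    then obtain H where H: "k = card (edges H)" "H \<in> \<G>" "card (verts H) = ?n" by blast
    then have "simple_graph H" using minor_closedD(1)[OF assms(1)] by blast
    then have "card (edges H) \<le> card (Pow (verts H))"
      by (intro card_mono) (auto simp: simple_graph_def)
    then show "k \<in> {..2 ^ ?n}"
      using H \<open>simple_graph H\<close> by (simp add: card_Pow simple_graph_def)
  qed
  then have fin: "finite ?A" by (rule finite_subset) simp
  have mem: "card (edges G) \<in> ?A" using assms(2) by blast
  show "card (edges G) \<le> ex \<G> ?n" unfolding ex_def using Max_ge[OF fin mem] .
  have "?A \<noteq> {}" using mem by blast
  from Max_in[OF fin this]
  obtain H where "Max ?A = card (edges H)" "H \<in> \<G>" "card (verts H) = ?n" by blast
  then show "\<exists>H\<in>\<G>. card (verts H) = ?n \<and> card (edges H) = ex \<G> ?n" unfolding ex_def by metis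
qed

section \<open>Isomorphism types and finite classes\<close>

lemma isomorphicI:
  "bij_betw f (verts G) (verts H) \<Longrightarrow> edges H = (`) f ` edges G \<Longrightarrow> isomorphic G H"
  unfolding isomorphic_def by (intro exI conjI)

lemma isomorphicE:
  assumes "isomorphic G H"
  obtains f where "bij_betw f (verts G) (verts H)" "edges H = (`) f ` edges G"
  using assms unfolding isomorphic_def by (elim exE conjE)

lemma isomorphic_trans:
  assumes "isomorphic F G" "isomorphic G H" shows "isomorphic F H"
proof -
  obtain f where f: "bij_betw f (verts F) (verts G)" "edges G = (`) f ` edges F"
    using assms(1) by (rule isomorphicE)
  obtain g where g: "bij_betw g (verts G) (verts H)" "edges H = (`) g ` edges G"
    using assms(2) by (rule isomorphicE)
  have "edges H = (`) (g \<circ> f) ` edges F" unfolding g(2) f(2) by (simp add: image_image image_comp)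
  with bij_betw_trans[OF f(1) g(1)] show ?thesis by (rule isomorphicI)
qed

text \<open>Simplicity of \<open>G\<close> puts its edges inside \<open>verts G\<close>, where the
  inverse of \<open>f\<close> undoes \<open>f\<close>.\<close>

lemma isomorphic_sym:
  assumes "simple_graph G" "isomorphic G H" shows "isomorphic H G"
proof -
  obtain f where f: "bij_betw f (verts G) (verts H)" "edges H = (`) f ` edges G"
    using assms(2) by (rule isomorphicE)
  let ?g = "inv_into (verts G) f"
  have "?g ` f ` e = e" if "e \<in> edges G" for e
    using that assms(1) bij_betw_imp_inj_on[OF f(1)]
    by (intro inv_into_image_cancel) (simp_all add: simple_graph_def)
  then have "edges G = (`) ?g ` edges H" unfolding f(2) by (simp add: image_image)
  with bij_betw_inv_into[OF f(1)] show ?thesis by (rule isomorphicI)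
qed

text \<open>The number of vertices is constant on an isomorphism type, so finitely many types give a
  bound. Conversely every type has a representative on an initial segment, and there are finitely
  many of these up to size \<open>b\<close>.\<close>

lemma finite_class_iff:
  assumes "\<And>G. G \<in> \<G> \<Longrightarrow> simple_graph G"
  shows "finite_class \<G> \<longleftrightarrow> (\<exists>b. \<forall>G\<in>\<G>. card (verts G) \<le> b)"
proof
  let ?r = "{(G :: nat graph, H :: nat graph). isomorphic G H}"
  assume "finite_class \<G>"
  then have fin: "finite (\<G> // ?r)" by (simp add: finite_class_def)
  define g where "g X = card (verts (SOME H. H \<in> X))" for X :: "nat graph set"
  have "card (verts G) \<in> g ` (\<G> // ?r)" if "G \<in> \<G>" for G
  proof -
    have "isomorphic G G" by (rule isomorphicI[of id]) simp_all
    then have "G \<in> ?r `` {G}" by simp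
    then have "(SOME H. H \<in> ?r `` {G}) \<in> ?r `` {G}" by (rule someI)
    then have "isomorphic G (SOME H. H \<in> ?r `` {G})" by simp
    then have "card (verts G) = g (?r `` {G})"
      unfolding g_def isomorphic_def by (auto dest: bij_betw_same_card)
    then show ?thesis by (rule image_eqI) (rule quotientI[OF that])
  qed
  then have "(\<lambda>G. card (verts G)) ` \<G> \<subseteq> g ` (\<G> // ?r)" by blast
  then have "finite ((\<lambda>G. card (verts G)) ` \<G>)" by (rule finite_subset) (rule finite_imageI[OF fin])
  then show "\<exists>b. \<forall>G\<in>\<G>. card (verts G) \<le> b" unfolding finite_nat_set_iff_bounded_le by simp
next
  let ?r = "{(G :: nat graph, H :: nat graph). isomorphic G H}"
  assume "\<exists>b. \<forall>G\<in>\<G>. card (verts G) \<le> b"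
  then obtain b where b: "\<And>G. G \<in> \<G> \<Longrightarrow> card (verts G) \<le> b" by blast
  let ?C = "(\<lambda>(k, E). Graph {..<k} E) ` ({..b} \<times> Pow (Pow {..<b}))"
  have "\<G> // ?r \<subseteq> (\<lambda>H. ?r `` {H}) ` ?C"
  proof
    fix X assume "X \<in> \<G> // ?r"
    then obtain G where G: "X = ?r `` {G}" "G \<in> \<G>" by (rule quotientE)
    have simple: "simple_graph G" using assms[OF G(2)] .
    then have "finite (verts G)" by (simp add: simple_graph_def)
    then obtain f where f: "bij_betw f (verts G) {..<card (verts G)}"
      using ex_bij_betw_finite_nat by (auto simp: atLeast0LessThan)
    let ?H = "Graph {..<card (verts G)} ((`) f ` edges G)"
    have iso: "isomorphic G ?H" unfolding isomorphic_def using f by auto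
    \<comment> \<open>\<open>F\<close> ranges over all graphs, also non-simple ones; symmetry is
      applied only to the simple graph \<open>G\<close>.\<close>
    then have "isomorphic G F \<longleftrightarrow> isomorphic ?H F" for F :: "nat graph"
      using isomorphic_trans[OF iso] isomorphic_trans[OF isomorphic_sym[OF simple iso]] by blast
    then have "X = ?r `` {?H}" using G(1) by simp
    moreover have "f ` e \<subseteq> {..<b}" if "e \<in> edges G" for e
    proof -
      have "f ` e \<subseteq> f ` verts G" using that simple by (auto simp: simple_graph_def)
      then show ?thesis using f b[OF G(2)] by (auto simp: bij_betw_def)
    qed
    then have "?H \<in> ?C" using b[OF G(2)] by (intro image_eqI[of _ _ "(card (verts G), (`) f ` edges G)"]) auto
    ultimately show "X \<in> (\<lambda>H. ?r `` {H}) ` ?C" by blast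
  qed
  moreover have "finite ((\<lambda>H. ?r `` {H}) ` ?C)" by simp
  ultimately show "finite_class \<G>" unfolding finite_class_def by (rule finite_subset)
qed

lemma infinite_class_members:
  assumes "minor_closed \<G>" "\<not> finite_class \<G>"
  obtains G where "G \<in> \<G>" "card (verts G) = n"
proof -
  obtain G where G: "G \<in> \<G>" "n \<le> card (verts G)"
    using assms finite_class_iff[of \<G>] minor_closedD(1) by (metis linorder_le_cases)
  then obtain X where X: "X \<subseteq> verts G" "card X = n" by (metis obtain_subset_with_card_n)
  have "card (verts (induced G X)) = n" using X by (simp add: Int_absorb1)
  then show ?thesis using that minor_closed_induced[OF assms(1) G(1)] by blast
qed

lemma simple_complete_graph: "simple_graph (complete_graph n)"
  by (auto simp: simple_graph_def complete_graph_def)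

text \<open>A simple graph outside the class is a minor of the complete graph on as many vertices,
  which therefore is a minor of no member.\<close>

lemma proper_minor_closed_excludes:
  assumes "proper_minor_closed \<G>"
  obtains t where "\<And>G. G \<in> \<G> \<Longrightarrow> \<not> is_minor (complete_graph t) G"
proof -
  obtain H where H: "simple_graph H" "H \<notin> \<G>"
    using assms by (auto simp: proper_minor_closed_def minor_closed_def)
  have "\<not> is_minor (complete_graph (card (verts H))) G" if "G \<in> \<G>" for G
    using minor_closedD(2)[OF _ that H(1)] is_minor_trans[OF is_minor_of_complete_graph[OF H(1)]]
      H(2) assms unfolding proper_minor_closed_def by blast
  then show ?thesis using that by blast
qed

text \<open>An extremal graph on \<open>n\<close> vertices has an induced subgraph on
  \<open>m\<close> vertices that is almost as dense and lies in the class.\<close>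

lemma ex_ratio_quasi_decreasing:
  fixes \<epsilon> :: real
  assumes \<G>: "proper_minor_closed \<G>" "\<not> finite_class \<G>" and "0 < \<epsilon>"
  shows "\<exists>n0. \<forall>m\<ge>n0. \<forall>n\<ge>m. (1 - \<epsilon>) * (real (ex \<G> n) / real n) \<le> real (ex \<G> m) / real m"
proof -
  have mc: "minor_closed \<G>" using \<G> by (simp add: proper_minor_closed_def)
  define \<eta> where "\<eta> = \<epsilon> / 2"
  have \<eta>: "0 < \<eta>" "\<epsilon> = 2 * \<eta>" using assms(3) by (simp_all add: \<eta>_def)
  obtain t where t: "\<And>G. G \<in> \<G> \<Longrightarrow> \<not> is_minor (complete_graph t) G"
    using proper_minor_closed_excludes[OF \<G>(1)] by blast
  from exists_dense_induced[OF \<eta>(1), where t = t and 'a = nat] obtain r where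
    r: "\<forall>(G :: nat graph) m. simple_graph G \<longrightarrow> \<not> is_minor (complete_graph t) G \<longrightarrow>
      r \<le> m \<longrightarrow> m \<le> card (verts G) \<longrightarrow> (\<exists>X\<subseteq>verts G. card X = m \<and>
      real (card (edges G)) * real (m - r) \<le>
        real (card (edges (induced G X))) * (real (card (verts G)) * (1 + \<eta>)))"
    by (elim exE)
  \<comment> \<open>From here on \<open>r \<le> \<eta> * m\<close>, so that \<open>m - r\<close> is
    at least \<open>(1 - \<eta>) * m\<close>.\<close>
  define n0 where "n0 = Suc (r + nat \<lceil>real r / \<eta>\<rceil>)"
  have "(1 - \<epsilon>) * (real (ex \<G> n) / real n) \<le> real (ex \<G> m) / real m" if m: "n0 \<le> m" "m \<le> n" for m n
  proof -
    obtain G where G: "G \<in> \<G>" "card (verts G) = n" "card (edges G) = ex \<G> n"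
      using infinite_class_members[OF mc \<G>(2), of n] card_edges_le_ex(2)[OF mc] by metis
    have rm: "r \<le> m" "0 < m" using m(1) by (auto simp: n0_def)
    have "real r / \<eta> \<le> real (nat \<lceil>real r / \<eta>\<rceil>)" by (rule real_nat_ceiling_ge)
    also have "\<dots> \<le> real m" unfolding of_nat_le_iff using m(1) unfolding n0_def by linarith
    finally have r\<eta>: "real r \<le> \<eta> * real m" using \<eta>(1) by (simp add: field_simps)
    have "m \<le> card (verts G)" using m(2) G(2) by simp
    from r[rule_format, OF minor_closedD(1)[OF mc G(1)] t[OF G(1)] rm(1) this]
    obtain X where X: "X \<subseteq> verts G" "card X = m"
      "real (ex \<G> n) * real (m - r) \<le> real (card (edges (induced G X))) * (real n * (1 + \<eta>))"
      unfolding G(2,3) by (elim exE conjE)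
    have "card (edges (induced G X)) \<le> ex \<G> m"
      using card_edges_le_ex(1)[OF mc minor_closed_induced[OF mc G(1)], of X] X(1,2)
      by (simp add: Int_absorb1)
    then have "real (card (edges (induced G X))) * (real n * (1 + \<eta>)) \<le> real (ex \<G> m) * (real n * (1 + \<eta>))"
      using \<eta>(1) by (intro mult_right_mono) auto
    then have up: "real (ex \<G> n) * real (m - r) \<le> real (ex \<G> m) * real n * (1 + \<eta>)"
      using X(3) by (simp add: mult_ac)
    \<comment> \<open>Since \<open>\<epsilon> = 2 * \<eta>\<close>, this factor pays both for the
      growth \<open>1 + \<eta>\<close> and for the loss of \<open>r\<close> vertices.\<close>
    have "(1 - \<epsilon>) * (1 + \<eta>) \<le> 1 - \<eta>" using \<eta> by (simp add: algebra_simps)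
    then have "(1 - \<epsilon>) * (1 + \<eta>) * real m \<le> (1 - \<eta>) * real m" by (rule mult_right_mono) simp
    also have "\<dots> \<le> real (m - r)" using rm r\<eta> by (simp add: of_nat_diff algebra_simps)
    finally have "real (ex \<G> n) * ((1 - \<epsilon>) * (1 + \<eta>) * real m) \<le> real (ex \<G> n) * real (m - r)"
      by (rule mult_left_mono) simp
    then have "(real (ex \<G> n) * (1 - \<epsilon>) * real m) * (1 + \<eta>) \<le> (real (ex \<G> m) * real n) * (1 + \<eta>)"
      using up by (simp add: mult_ac)
    then have "real (ex \<G> n) * (1 - \<epsilon>) * real m \<le> real (ex \<G> m) * real n"
      by (rule mult_right_le_imp_le) (use \<eta> in simp)
    then show ?thesis using rm(2) m(2) by (simp add: field_simps)
  qed
  then show ?thesis by blast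
qed

section \<open>Bounds on the limiting density\<close>

text \<open>\<open>lim\<close> says nothing about a divergent sequence; convergence over the reals
  makes it a genuine finite limit.\<close>

lemma limiting_density_limit:
  assumes "proper_minor_closed \<G>" "\<not> finite_class \<G>"
  obtains L where "(\<lambda>n. real (ex \<G> n) / real n) \<longlonglongrightarrow> L" "limiting_density \<G> = ereal L"
proof -
  have "convergent (\<lambda>n. real (ex \<G> n) / real n)"
    by (rule convergent_quasi_decreasing[OF _ ex_ratio_quasi_decreasing[OF assms]]) simp_all
  then obtain L where L: "(\<lambda>n. real (ex \<G> n) / real n) \<longlonglongrightarrow> L" by (auto simp: convergent_def)
  then have "(\<lambda>n. ereal (real (ex \<G> n) / real n)) \<longlonglongrightarrow> ereal L" by (rule tendsto_ereal)
  from limI[OF this] show ?thesis using that[OF L] assms(2) by (simp add: limiting_density_def)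
qed

text \<open>As the limit exists, dense members of arbitrarily large size suffice, without one for
  every \<open>n\<close>. The additive \<open>d\<close> vanishes after division.\<close>

lemma limiting_density_ge:
  assumes \<G>: "proper_minor_closed \<G>"
    and large: "\<And>k. \<exists>G\<in>\<G>. k \<le> card (verts G) \<and> c * real (card (verts G)) - d \<le> real (card (edges G))"
  shows "ereal c \<le> limiting_density \<G>"
proof -
  have mc: "minor_closed \<G>" using \<G> by (simp add: proper_minor_closed_def)
  have "\<not> finite_class \<G>"
    using finite_class_iff[of \<G>, OF minor_closedD(1)[OF mc]] large by (meson not_less_eq_eq)
  from limiting_density_limit[OF \<G> this]
  obtain L where L: "(\<lambda>n. real (ex \<G> n) / real n) \<longlonglongrightarrow> L" "limiting_density \<G> = ereal L" .
  have "c \<le> L"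
  proof (rule ccontr)
    assume "\<not> c \<le> L"
    then have "(\<lambda>n. real (ex \<G> n) / real n + d / real n) \<longlonglongrightarrow> L + 0" "L + 0 < c"
      using tendsto_add[OF L(1) lim_const_over_n[of d]] by simp_all
    then have "\<forall>\<^sub>F n in sequentially. real (ex \<G> n) / real n + d / real n < c" by (rule order_tendstoD(2))
    then obtain N where N: "\<And>n. N \<le> n \<Longrightarrow> real (ex \<G> n) / real n + d / real n < c"
      by (auto simp: eventually_sequentially)
    obtain G where G: "G \<in> \<G>" "Suc N \<le> card (verts G)"
      "c * real (card (verts G)) - d \<le> real (card (edges G))" using large by blast
    let ?n = "card (verts G)"
    have "c * real ?n \<le> real (ex \<G> ?n) + d" using G(3) card_edges_le_ex(1)[OF mc G(1)] by linarith
    moreover have "0 < real ?n" using G(2) by simp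
    ultimately have "c \<le> (real (ex \<G> ?n) + d) / real ?n" by (simp add: le_divide_eq)
    moreover have "real (ex \<G> ?n) / real ?n + d / real ?n < c" by (rule N) (use G(2) in simp)
    ultimately show False unfolding add_divide_distrib by linarith
  qed
  then show ?thesis using L(2) by simp
qed

text \<open>Applied to extremal graphs, the bound passes to the limit; finite classes have density
  \<open>-\<infinity>\<close>.\<close>

lemma limiting_density_le:
  assumes \<G>: "proper_minor_closed \<G>"
    and bound: "\<And>G. G \<in> \<G> \<Longrightarrow> real (card (edges G)) \<le> c * real (card (verts G)) + d"
  shows "limiting_density \<G> \<le> ereal c"
proof (cases "finite_class \<G>")
  case True
  then show ?thesis by (simp add: limiting_density_def)
next
  case False
  have mc: "minor_closed \<G>" using \<G> by (simp add: proper_minor_closed_def)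
  from limiting_density_limit[OF \<G> False]
  obtain L where L: "(\<lambda>n. real (ex \<G> n) / real n) \<longlonglongrightarrow> L" "limiting_density \<G> = ereal L" .
  have "real (ex \<G> n) / real n \<le> c + d / real n" if "1 \<le> n" for n
  proof -
    obtain G where "G \<in> \<G>" "card (verts G) = n" "card (edges G) = ex \<G> n"
      using infinite_class_members[OF mc False, of n] card_edges_le_ex(2)[OF mc] by metis
    then have "real (ex \<G> n) \<le> c * real n + d" using bound by metis
    then show ?thesis using that by (simp add: field_simps)
  qed
  moreover have "(\<lambda>n. c + d / real n) \<longlonglongrightarrow> c"
    using tendsto_add[OF tendsto_const lim_const_over_n[of d]] by simp
  ultimately have "L \<le> c" using LIMSEQ_le[OF L(1)] by blast
  then show ?thesis using L(2) by simp
qed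

section \<open>Densities of the obstructions\<close>

lemma simple_copies:
  assumes "simple_graph H"
  shows "simple_graph (copies k H)" "card (verts (copies k H)) = k * card (verts H)"
    "card (edges (copies k H)) = k * card (edges H)"
proof -
  have sub: "e \<subseteq> verts H" "card e = 2" if "e \<in> edges H" for e
    using assms that by (auto simp: simple_graph_def)
  have "card (Pair i ` e) = 2" if "e \<in> edges H" for i :: nat and e
    using sub[OF that] by (simp add: card_image inj_on_def)
  then show "simple_graph (copies k H)"
    using assms sub by (fastforce simp: simple_graph_def copies_def)
  show "card (verts (copies k H)) = k * card (verts H)"
    by (simp add: copies_def card_cartesian_product)
  have img: "edges (copies k H) = (\<lambda>(i, e). Pair i ` e) ` ({..<k} \<times> edges H)"
    by (auto simp: copies_def)
  have "inj_on (\<lambda>(i, e). Pair i ` e) ({..<k} \<times> edges H)"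
  proof (rule inj_onI, clarify)
    fix i j e e' assume e: "e \<in> edges H" "e' \<in> edges H" and eq: "Pair i ` e = Pair j ` e'"
    have "e \<noteq> {}" using sub(2)[OF e(1)] by auto
    then have "i = j" using eq by auto
    moreover have "snd ` Pair i ` e = snd ` Pair j ` e'" using eq by simp
    ultimately show "i = j \<and> e = e'" by (simp add: image_image)
  qed
  then show "card (edges (copies k H)) = k * card (edges H)"
    unfolding img by (simp add: card_image card_cartesian_product)
qed

lemma copies_edge_fst: "{p, q} \<in> edges (copies k H) \<Longrightarrow> fst p = fst q"
proof -
  assume "{p, q} \<in> edges (copies k H)"
  then obtain i e where "{p, q} = Pair i ` e" by (auto simp: copies_def)
  then have "p \<in> Pair i ` e" "q \<in> Pair i ` e" by auto
  then show ?thesis by auto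
qed

text \<open>Branch sets are connected and touch each other, so all lie in one copy of
  \<open>H\<close>; one vertex from each gives \<open>n\<close> distinct vertices of that
  copy.\<close>

lemma complete_graph_minor_copies:
  assumes "finite (verts H)" "is_minor (complete_graph n) (copies k H)" "2 \<le> n"
  shows "n \<le> card (verts H)"
proof -
  from assms(2) obtain B where B: "\<And>v. v \<in> verts (complete_graph n) \<Longrightarrow> connected_set (copies k H) (B v)"
    "\<And>u v. u \<in> verts (complete_graph n) \<Longrightarrow> v \<in> verts (complete_graph n) \<Longrightarrow> u \<noteq> v \<Longrightarrow> B u \<inter> B v = {}"
    "\<And>u v. {u, v} \<in> edges (complete_graph n) \<Longrightarrow> touching (copies k H) (B u) (B v)"
    by (rule is_minorE) blast
  have Bc: "connected_set (copies k H) (B v)" if "v < n" for v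
    using B(1) that by (simp add: complete_graph_def)
  have conn: "fst p = fst q" if v: "v < n" "p \<in> B v" "q \<in> B v" for v p q
  proof -
    have "(p, q) \<in> (adj (copies k H) (B v))\<^sup>*" using v(2,3) Bc[OF v(1)] by (simp add: connected_set_iff_adj)
    then show ?thesis
    proof induction
      case (step y z)
      then have "{y, z} \<in> edges (copies k H)" by (simp add: adj_def)
      then show ?case using copies_edge_fst step.IH by metis
    qed simp
  qed
  have "0 < n" using assms(3) by simp
  then obtain p0 where p0: "p0 \<in> B 0" using connected_set_nonempty[OF Bc] by blast
  \<comment> \<open>The branch set of vertex 0 serves as reference: every other one touches
    it.\<close>
  have same: "fst p = fst p0" if v: "v < n" "p \<in> B v" for v p
  proof (cases "v = 0")
    case True
    then show ?thesis using conn[OF v _] p0 by simp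
  next
    case False
    then have "{0, v} \<in> edges (complete_graph n)" using v(1) by (simp add: complete_graph_def)
    from B(3)[OF this] obtain a b where ab: "a \<in> B 0" "b \<in> B v" "{a, b} \<in> edges (copies k H)"
      unfolding touching_def by (elim bexE)
    have "fst a = fst p0" using conn[OF \<open>0 < n\<close> ab(1) p0] .
    moreover have "fst p = fst b" using conn[OF v ab(2)] .
    ultimately show ?thesis using copies_edge_fst[OF ab(3)] by simp
  qed
  have "\<exists>p. p \<in> B v" if "v < n" for v
    using connected_set_nonempty[OF Bc[OF that]] by blast
  then obtain b where b: "\<And>v. v < n \<Longrightarrow> b v \<in> B v" by metis
  have "inj_on b {..<n}"
  proof (rule inj_onI)
    fix u v assume uv: "u \<in> {..<n}" "v \<in> {..<n}" "b u = b v"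
    then have "B u \<inter> B v \<noteq> {}" using b[of u] b[of v] by auto
    then show "u = v" using B(2)[of u v] uv(1,2) by (auto simp: complete_graph_def)
  qed
  moreover have "b ` {..<n} \<subseteq> {fst p0} \<times> verts H"
  proof
    fix p assume "p \<in> b ` {..<n}"
    then obtain v where v: "v < n" "p \<in> B v" using b by auto
    then have "p \<in> verts (copies k H)" using connected_set_subset[OF Bc] by blast
    then show "p \<in> {fst p0} \<times> verts H" using same[OF v] by (auto simp: copies_def)
  qed
  ultimately have "card {..<n} \<le> card ({fst p0} \<times> verts H)"
    using assms(1) by (intro card_inj_on_le) auto
  then show ?thesis by (simp add: card_cartesian_product)
qed

lemma proper_class_of_copies:
  assumes "finite (verts H)"
  shows "proper_minor_closed (class_of_copies H)"
proof -
  \<comment> \<open>Adding 2 exceeds the size of \<open>H\<close> and gives at least 2 vertices even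
    when \<open>H\<close> is empty.\<close>
  have "\<not> is_minor (complete_graph (card (verts H) + 2)) (copies k H)" for k
    using complete_graph_minor_copies[OF assms, of "card (verts H) + 2" k] by linarith
  then have "complete_graph (card (verts H) + 2) \<notin> class_of_copies H" by (simp add: class_of_copies_def)
  then have "class_of_copies H \<noteq> {G. simple_graph G}" using simple_complete_graph by blast
  moreover have "minor_closed (class_of_copies H)"
    unfolding minor_closed_def class_of_copies_def using is_minor_trans by blast
  ultimately show ?thesis by (simp add: proper_minor_closed_def)
qed

lemma simple_star:
  shows "simple_graph (star k)" "card (verts (star k)) = Suc k" "card (edges (star k)) = k"
proof -
  show "simple_graph (star k)" by (auto simp: simple_graph_def star_def)
  show "card (verts (star k)) = Suc k" by (simp add: star_def)
  have "edges (star k) = (\<lambda>i. {0, i}) ` {1..k}" by (auto simp: star_def)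
  moreover have "inj_on (\<lambda>i. {0, i}) {1..k}" by (auto simp: inj_on_def doubleton_eq_iff)
  ultimately show "card (edges (star k)) = k" by (simp add: card_image)
qed

lemma proper_class2: "proper_minor_closed class2"
proof -
  have "\<not> is_minor (complete_graph 3) (star k)" for k
  proof
    assume "is_minor (complete_graph 3) (star k)"
    then obtain B where B: "\<And>u v. u \<in> verts (complete_graph 3) \<Longrightarrow> v \<in> verts (complete_graph 3) \<Longrightarrow> u \<noteq> v \<Longrightarrow> B u \<inter> B v = {}"
      "\<And>u v. {u, v} \<in> edges (complete_graph 3) \<Longrightarrow> touching (star k) (B u) (B v)"
      by (rule is_minorE) blast
    \<comment> \<open>Every edge of a star contains the centre, so of two touching branch sets one
      contains it; three disjoint ones cannot all touch.\<close>
    have "0 \<in> B u \<or> 0 \<in> B v" if "u < 3" "v < 3" "u \<noteq> v" for u v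
    proof -
      have "touching (star k) (B u) (B v)" using that by (intro B(2)) (auto simp: complete_graph_def)
      then obtain a b where "a \<in> B u" "b \<in> B v" "{a, b} \<in> edges (star k)" by (auto simp: touching_def)
      then show ?thesis by (auto simp: star_def doubleton_eq_iff)
    qed
    from this[of 0 1] this[of 1 2] this[of 0 2] B(1)[of 0 1] B(1)[of 1 2] B(1)[of 0 2]
    show False by (auto simp: complete_graph_def)
  qed
  then have "complete_graph 3 \<notin> class2" by (simp add: class2_def)
  then have "class2 \<noteq> {G. simple_graph G}" using simple_complete_graph by blast
  moreover have "minor_closed class2"
    unfolding minor_closed_def class2_def using is_minor_trans by blast
  ultimately show ?thesis by (simp add: proper_minor_closed_def)
qed

text \<open>Disjoint copies have the same ratio of edges to vertices as \<open>H\<close>, at any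
  size.\<close>

lemma limiting_density_copies:
  assumes \<G>: "proper_minor_closed \<G>" "class_of_copies H \<subseteq> \<G>"
    and H: "simple_graph H" "verts H \<noteq> {}" and c: "c * real (card (verts H)) \<le> real (card (edges H))"
  shows "ereal c \<le> limiting_density \<G>"
proof (rule limiting_density_ge[OF \<G>(1), where d = 0])
  fix k
  let ?n = "card (verts H)"
  have "1 \<le> ?n" using H by (simp add: simple_graph_def Suc_le_eq card_gt_0_iff)
  obtain G :: "nat graph" where G: "simple_graph G" "is_minor G (copies (Suc k) H)"
    "card (verts G) = Suc k * ?n" "card (edges G) = Suc k * card (edges H)"
    using exists_nat_copy[OF simple_copies(1)[OF H(1), of "Suc k"]] simple_copies(2,3)[OF H(1), of "Suc k"]
    by metis
  have "G \<in> \<G>" using G(1,2) \<G>(2) by (auto simp: class_of_copies_def)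
  moreover have "k \<le> card (verts G)"
  proof -
    have "Suc k * 1 \<le> Suc k * ?n" using \<open>1 \<le> ?n\<close> by (rule mult_le_mono2)
    then show ?thesis unfolding G(3) by simp
  qed
  moreover have "real (Suc k) * (c * real ?n) \<le> real (Suc k) * real (card (edges H))"
    using c by (rule mult_left_mono) simp
  then have "c * real (card (verts G)) - 0 \<le> real (card (edges G))" unfolding G by (simp add: algebra_simps)
  ultimately show "\<exists>G\<in>\<G>. k \<le> card (verts G) \<and> c * real (card (verts G)) - 0 \<le> real (card (edges G))"
    by blast
qed

lemma limiting_density_stars:
  assumes "proper_minor_closed \<G>" "class2 \<subseteq> \<G>"
  shows "ereal 1 \<le> limiting_density \<G>"
proof (rule limiting_density_ge[OF assms(1), where d = 1])
  fix k
  have "is_minor (star (Suc k)) (star (Suc k))" by (rule is_minor_subgraph) auto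
  then have "\<exists>k'\<ge>1. is_minor (star (Suc k)) (star k')" by (intro exI[of _ "Suc k"]) simp
  then have "star (Suc k) \<in> class2" by (simp add: class2_def simple_star(1))
  then have "star (Suc k) \<in> \<G>" using assms(2) by blast
  then show "\<exists>G\<in>\<G>. k \<le> card (verts G) \<and> 1 * real (card (verts G)) - 1 \<le> real (card (edges G))"
    by (intro bexI[of _ "star (Suc k)"]) (simp_all add: simple_star)
qed

section \<open>What missing an obstruction implies for a class\<close>

text \<open>A missing graph \<open>F\<close> is a minor of some \<open>copies k H\<close>; a member
  having that as a minor would bring \<open>F\<close> into the class.\<close>

lemma excluded_copies:
  assumes "minor_closed \<G>" "\<not> class_of_copies H \<subseteq> \<G>"
  shows "\<exists>k. \<forall>G\<in>\<G>. \<not> is_minor (copies k H) G"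
proof -
  obtain F k where F: "simple_graph F" "is_minor F (copies k H)" "F \<notin> \<G>"
    using assms(2) by (auto simp: class_of_copies_def)
  then have "\<not> is_minor (copies k H) G" if "G \<in> \<G>" for G
    using is_minor_trans[OF F(2)] minor_closedD(2)[OF assms(1) that F(1)] by blast
  then show ?thesis by blast
qed

lemma excluded_star:
  assumes "minor_closed \<G>" "\<not> class2 \<subseteq> \<G>"
  shows "\<exists>k. \<forall>G\<in>\<G>. \<not> is_minor (star k) G"
proof -
  obtain F k where F: "simple_graph F" "is_minor F (star k)" "F \<notin> \<G>"
    using assms(2) by (auto simp: class2_def)
  then have "\<not> is_minor (star k) G" if "G \<in> \<G>" for G
    using is_minor_trans[OF F(2)] minor_closedD(2)[OF assms(1) that F(1)] by blast
  then show ?thesis by blast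
qed

text \<open>A vertex with more than \<open>k\<close> neighbours is the centre of a star with
  \<open>k\<close> leaves.\<close>

lemma card_incident_edges_le:
  assumes G: "simple_graph G" and v: "v \<in> verts G" and no: "\<not> is_minor (star k) G"
  shows "card {e \<in> edges G. v \<in> e} \<le> k"
proof -
  define W where "W = {w. {v, w} \<in> edges G}"
  have W: "W \<subseteq> verts G" "v \<notin> W"
    using simple_graph_edge(2,3)[OF G, of v] unfolding W_def by blast+
  have finW: "finite W" using W(1) G by (auto simp: simple_graph_def intro: finite_subset)
  have "{e \<in> edges G. v \<in> e} \<subseteq> (\<lambda>w. {v, w}) ` W"
  proof
    fix e assume e: "e \<in> {e \<in> edges G. v \<in> e}"
    then obtain a b where ab: "e = {a, b}" using simple_graph_edgeE[OF G, of e] by blast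
    then obtain w where "e = {v, w}" using e by (metis (no_types) CollectD insert_commute insertE singletonD)
    then show "e \<in> (\<lambda>w. {v, w}) ` W" using e by (auto simp: W_def)
  qed
  then have "card {e \<in> edges G. v \<in> e} \<le> card W" using finW by (rule surj_card_le[rotated])
  also have "card W \<le> k"
  proof (rule ccontr)
    assume "\<not> card W \<le> k"
    then have "card {1..k} \<le> card W" unfolding card_atLeastAtMost by linarith
    then have "\<exists>f. f ` {1..k} \<subseteq> W \<and> inj_on f {1..k}"
      by (rule card_le_inj[OF finite_atLeastAtMost finW])
    then obtain f where f: "f ` {1..k} \<subseteq> W" "inj_on f {1..k}" by blast
    let ?g = "\<lambda>i. if i = 0 then v else f i"
    have "is_minor (star k) G"
    proof (rule is_minor_inj[of ?g])
      have fW: "f i \<in> W" if "i \<in> {1..k}" for i using subsetD[OF f(1) imageI[OF that]] .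
      have vs: "verts (star k) = insert 0 {1..k}" by (auto simp: star_def)
      have "inj_on ?g {1..k}" by (rule inj_on_cong[THEN iffD1, OF _ f(2)]) simp
      moreover have "?g 0 \<notin> ?g ` {1..k}"
      proof
        assume "?g 0 \<in> ?g ` {1..k}"
        then obtain i where "i \<in> {1..k}" "v = f i" by auto
        then show False using fW W(2) by blast
      qed
      ultimately show "inj_on ?g (verts (star k))" unfolding vs by (simp only: inj_on_insert) simp
      show "?g ` verts (star k) \<subseteq> verts G"
      proof
        fix w assume "w \<in> ?g ` verts (star k)"
        then have "w = v \<or> w \<in> f ` {1..k}" unfolding vs by auto
        then show "w \<in> verts G" using f(1) W(1) v by blast
      qed
      show "{?g i, ?g j} \<in> edges G" if "{i, j} \<in> edges (star k)" for i j
      proof -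
        from that obtain l where l: "l \<in> {1..k}" "i = 0 \<and> j = l \<or> i = l \<and> j = 0"
          by (auto simp: star_def doubleton_eq_iff)
        have "{v, f l} \<in> edges G" using fW[OF l(1)] by (simp add: W_def)
        moreover have "l \<noteq> 0" using l(1) by simp
        ultimately show ?thesis using l(2) by (elim disjE conjE) (simp_all add: insert_commute)
      qed
    qed
    then show False using no by blast
  qed
  finally show ?thesis .
qed

text \<open>Any \<open>k\<close> of the disjoint hosts together would carry
  \<open>copies k H\<close>.\<close>

lemma card_disjoint_hosts_le:
  assumes no: "\<not> is_minor (copies k H) G" and dis: "pairwise disjnt F"
    and host: "\<And>S. S \<in> F \<Longrightarrow> is_minor H (induced G S)"
  shows "card F \<le> k"
proof (rule ccontr)
  assume "\<not> card F \<le> k"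
  then obtain F' where F': "F' \<subseteq> F" "card F' = k" "finite F'"
    by (metis obtain_subset_with_card_n nat_le_linear)
  then obtain S where S: "bij_betw S {..<k} F'"
    using ex_bij_betw_nat_finite[of F'] by (auto simp: atLeast0LessThan)
  then have SF: "S i \<in> F" if "i < k" for i using that F'(1) by (auto simp: bij_betw_def)
  have Sne: "S i \<noteq> S j" if "i < k" "j < k" "i \<noteq> j" for i j
    using S that by (auto simp: bij_betw_def inj_on_def)
  have "is_minor (copies k H) G"
  proof (rule is_minor_copies)
    show "is_minor H (induced G (S i))" if "i < k" for i by (rule host) (rule SF[OF that])
    show "S i \<inter> S j = {}" if "i < k" "j < k" "i \<noteq> j" for i j
      using pairwiseD[OF dis SF[OF that(1)] SF[OF that(2)] Sne[OF that]] by (simp add: disjnt_def)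
  qed
  then show False using no by blast
qed

text \<open>Each missing class yields one packing hypothesis: stars bound the degrees, triangles the
  disjoint cyclic sets, and trees the disjoint connected sets of \<open>x + 2\<close>
  vertices.\<close>

lemma limiting_density_le_if_excluded:
  fixes \<G> :: "nat graph set"
  assumes \<G>: "proper_minor_closed \<G>" and no1: "\<not> class1 \<subseteq> \<G>" and no2: "\<not> class2 \<subseteq> \<G>"
    and noT: "\<And>T. T \<in> trees (x + 2) \<Longrightarrow> \<not> class_of_copies T \<subseteq> \<G>"
  shows "limiting_density \<G> \<le> ereal (real x / real (x + 1))"
proof -
  have mc: "minor_closed \<G>" using \<G> by (simp add: proper_minor_closed_def)
  obtain q where q: "\<And>G. G \<in> \<G> \<Longrightarrow> \<not> is_minor (copies q (complete_graph 3)) G"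
    using excluded_copies[OF mc no1[unfolded class1_def]] by blast
  obtain d where d: "\<And>G. G \<in> \<G> \<Longrightarrow> \<not> is_minor (star d) G"
    using excluded_star[OF mc no2] by blast
  \<comment> \<open>With \<open>a = x + 1\<close>, the coefficient \<open>(a - 1) / a\<close> of the
    packing bound is \<open>x / (x + 1)\<close>.\<close>
  define a where "a = Suc x"
  \<comment> \<open>\<open>trees (x + 2)\<close> contains every labelling and is infinite; fixing
    the vertex set leaves finitely many trees.\<close>
  define TT where "TT = {T :: nat graph. is_tree T \<and> verts T = {..<Suc a}}"
  have "TT \<subseteq> Graph {..<Suc a} ` Pow (Pow {..<Suc a})"
  proof
    fix T assume T: "T \<in> TT"
    then have "edges T \<in> Pow (Pow {..<Suc a})" by (auto simp: TT_def is_tree_def simple_graph_def)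
    moreover have "T = Graph {..<Suc a} (edges T)" using T by (cases T) (simp add: TT_def)
    ultimately show "T \<in> Graph {..<Suc a} ` Pow (Pow {..<Suc a})" by blast
  qed
  then have finTT: "finite TT" by (rule finite_subset) simp
  have "\<forall>T\<in>TT. \<exists>k. \<forall>G\<in>\<G>. \<not> is_minor (copies k T) G"
  proof
    fix T assume "T \<in> TT"
    then have "T \<in> trees (x + 2)" by (auto simp: TT_def trees_def a_def)
    from excluded_copies[OF mc noT[OF this]] show "\<exists>k. \<forall>G\<in>\<G>. \<not> is_minor (copies k T) G" .
  qed
  from bchoice[OF this] obtain k where k: "\<And>T G. T \<in> TT \<Longrightarrow> G \<in> \<G> \<Longrightarrow> \<not> is_minor (copies (k T) T) G"
    by blast
  \<comment> \<open>Each packed set hosts a spanning tree from \<open>TT\<close>, and at most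
    \<open>k T\<close> disjoint sets host the same tree \<open>T\<close>.\<close>
  define p where "p = (\<Sum>T\<in>TT. k T)"
  define C where "C = p * Suc a * d + q * 2 ^ a"
  have pack: "a * card (edges G) \<le> (a - 1) * card (verts G) + a * C" if G: "G \<in> \<G>" for G
    unfolding C_def
  proof (rule edges_le_of_bounded_packings)
    show simple: "simple_graph G" using minor_closedD(1)[OF mc G] .
    show "card {e \<in> edges G. v \<in> e} \<le> d" if "v \<in> verts G" for v
      using card_incident_edges_le[OF simple that d[OF G]] .
    show "card F \<le> q" if "\<And>S. S \<in> F \<Longrightarrow> connected_set G S \<and> is_minor (complete_graph 3) (induced G S)"
      "pairwise disjnt F" for F
      using card_disjoint_hosts_le[OF q[OF G] that(2)] that(1) by blast
    show "card F \<le> p" if F: "\<And>S. S \<in> F \<Longrightarrow> connected_set G S \<and> card S = Suc a" "pairwise disjnt F" for F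
    \<comment> \<open>An infinite \<open>F\<close> has cardinality 0.\<close>
    proof (cases "finite F")
      case True
      define host where "host T = {S \<in> F. is_minor T (induced G S)}" for T :: "nat graph"
      have "\<exists>T\<in>TT. S \<in> host T" if "S \<in> F" for S
      proof -
        have S: "connected_set G S" "card S = Suc a" using F(1)[OF that] by auto
        then have "finite S" by (intro card_ge_0_finite) simp
        from connected_set_spanning_tree[OF S(1) this] show ?thesis
          using S(2) that unfolding host_def TT_def by (metis (mono_tags, lifting) mem_Collect_eq)
      qed
      then have "F \<subseteq> (\<Union>T\<in>TT. host T)" by blast
      moreover have "finite (\<Union>T\<in>TT. host T)" using True finTT by (auto simp: host_def)
      ultimately have "card F \<le> card (\<Union>T\<in>TT. host T)" by (rule card_mono[rotated])
      also have "\<dots> \<le> (\<Sum>T\<in>TT. card (host T))" using finTT by (rule card_UN_le)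
      also have "\<dots> \<le> (\<Sum>T\<in>TT. k T)"
      proof (rule sum_mono)
        fix T assume T: "T \<in> TT"
        have "pairwise disjnt (host T)" using F(2) by (rule pairwise_subset) (auto simp: host_def)
        then show "card (host T) \<le> k T"
          by (rule card_disjoint_hosts_le[OF k[OF T G]]) (simp add: host_def)
      qed
      finally show ?thesis by (simp add: p_def)
    qed simp
  qed
  have bound: "real (card (edges G)) \<le> real x / real (x + 1) * real (card (verts G)) + real C"
    if "G \<in> \<G>" for G
  proof -
    have "Suc x * card (edges G) \<le> x * card (verts G) + Suc x * C"
      using pack[OF that] by (simp add: a_def)
    then have "real (Suc x * card (edges G)) \<le> real (x * card (verts G) + Suc x * C)"
      by (simp only: of_nat_le_iff)
    then show ?thesis by (simp add: field_simps)
  qed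
  show ?thesis using limiting_density_le[OF \<G> bound] .
qed

section \<open>Class obstructions as minimal elements of an upward closed family\<close>

theorem theorem3p16:
  fixes \<delta> :: real and x :: nat
  assumes "0 \<le> \<delta>" and "\<delta> < 1"
    and "x = nat \<lfloor>\<delta> / (1 - \<delta>)\<rfloor>"
  shows "cobs (classes_of_density_le \<delta>) =
    min_classes ({class1, class2} \<union> {class_of_copies T |T. T \<in> trees (x + 2)})"
proof -
  let ?L = "{class1, class2} \<union> {class_of_copies T |T. T \<in> trees (x + 2)}"
  let ?U = "{\<G>. proper_minor_closed \<G> \<and> \<G> \<notin> classes_of_density_le \<delta>}"
  have fl: "real x = of_int \<lfloor>\<delta> / (1 - \<delta>)\<rfloor>" using assms by simp
  \<comment> \<open>Solving the floor inequalities for \<open>\<delta>\<close> gives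
    \<open>x / (x + 1) \<le> \<delta> < (x + 1) / (x + 2)\<close>: the edge densities of trees on
    \<open>x + 1\<close> and on \<open>x + 2\<close> vertices.\<close>
  have "real x \<le> \<delta> / (1 - \<delta>)" "\<delta> / (1 - \<delta>) < real x + 1" unfolding fl by linarith+
  then have "real x * (1 - \<delta>) \<le> \<delta>" "\<delta> < (real x + 1) * (1 - \<delta>)"
    using assms(2) by (simp_all add: pos_le_divide_eq pos_divide_less_eq)
  then have lo: "real x / real (x + 1) \<le> \<delta>" and hi: "\<delta> < real (x + 1) / real (x + 2)"
    by (simp_all add: divide_le_eq less_divide_eq algebra_simps)
  have tree: "simple_graph T" "card (verts T) = x + 2" "x + 1 \<le> card (edges T)" if "T \<in> trees (x + 2)" for T
  proof -
    show T: "simple_graph T" "card (verts T) = x + 2" using that by (auto simp: trees_def is_tree_def)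
    have "edges (induced T (verts T)) = edges T" using T(1) by (auto simp: simple_graph_def)
    moreover have "connected_set T (verts T)" using that by (auto simp: trees_def is_tree_def)
    ultimately show "x + 1 \<le> card (edges T)" using connected_set_many_edges[OF T(1)] T(2) by fastforce
  qed
  have triangle: "card (verts (complete_graph 3)) = 3" "card (edges (complete_graph 3)) = 3"
  proof -
    show "card (verts (complete_graph 3)) = 3" by (simp add: complete_graph_def)
    have "card (edges (complete_graph 3)) = 3 choose 2"
      unfolding complete_graph_def graph.sel using n_subsets[of "{..<3::nat}" 2] by simp
    then show "card (edges (complete_graph 3)) = 3" by (simp add: choose_two)
  qed
  have L_proper: "proper_minor_closed M" if M: "M \<in> ?L" for M
  proof -
    consider "M = class1" | "M = class2" | T where "T \<in> trees (x + 2)" "M = class_of_copies T"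
      using M by blast
    then show ?thesis
    proof cases
      case 1
      then show ?thesis unfolding class1_def
        using proper_class_of_copies[of "complete_graph 3"] by (simp add: complete_graph_def)
    next
      case 2
      then show ?thesis using proper_class2 by simp
    next
      case 3
      then show ?thesis using proper_class_of_copies[of T] tree(1) by (simp add: simple_graph_def)
    qed
  qed
  \<comment> \<open>\<open>?U\<close> contains every proper minor-closed class above a member of
    \<open>?L\<close>, since that member forces a density of 1 or of
    \<open>(x + 1) / (x + 2)\<close>.\<close>
  have up: "\<G> \<in> ?U" if \<G>: "proper_minor_closed \<G>" and M: "M \<in> ?L" "M \<subseteq> \<G>" for \<G> M
  proof -
    have "ereal \<delta> < limiting_density \<G>"
    proof -
      consider "M = class1" | "M = class2" | T where "T \<in> trees (x + 2)" "M = class_of_copies T"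
        using M(1) by blast
      then show ?thesis
      proof cases
        case 1
        have "verts (complete_graph 3) \<noteq> {}" using triangle(1) by auto
        then have "ereal 1 \<le> limiting_density \<G>"
          using limiting_density_copies[OF \<G> _ simple_complete_graph, of 3 1] M(2) 1 triangle
          by (simp add: class1_def)
        then show ?thesis using assms(2) by (meson less_ereal.simps(1) less_le_trans)
      next
        case 2
        then have "ereal 1 \<le> limiting_density \<G>" using limiting_density_stars[OF \<G>] M(2) by simp
        then show ?thesis using assms(2) by (meson less_ereal.simps(1) less_le_trans)
      next
        case 3
        have "real (x + 1) / real (x + 2) * real (card (verts T)) \<le> real (card (edges T))"
          using tree(2,3)[OF 3(1)] by simp
        moreover have "verts T \<noteq> {}" using tree(2)[OF 3(1)] by auto
        ultimately have "ereal (real (x + 1) / real (x + 2)) \<le> limiting_density \<G>"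
          using limiting_density_copies[OF \<G>] M(2) 3(2) tree(1)[OF 3(1)] by blast
        then show ?thesis using hi by (meson less_ereal.simps(1) less_le_trans)
      qed
    qed
    then show ?thesis using \<G> by (simp add: classes_of_density_le_def not_le)
  qed
  have down: "\<exists>M\<in>?L. M \<subseteq> \<G>" if \<G>: "\<G> \<in> ?U" for \<G>
  proof (rule ccontr)
    assume none: "\<not> (\<exists>M\<in>?L. M \<subseteq> \<G>)"
    have "limiting_density \<G> \<le> ereal (real x / real (x + 1))"
      by (rule limiting_density_le_if_excluded) (use \<G> none in blast)+
    also have "\<dots> \<le> ereal \<delta>" using lo by simp
    finally show False using \<G> by (simp add: classes_of_density_le_def)
  qed
  have LU: "?L \<subseteq> ?U" using up[OF L_proper] by blast
  \<comment> \<open>By \<open>LU\<close> and \<open>down\<close>, \<open>?L\<close> lies in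
    \<open>?U\<close> and below every element of \<open>?U\<close> there is one of
    \<open>?L\<close>; such families have the same minimal elements.\<close>
  have "min_classes ?U = min_classes ?L"
  proof (rule equalityI; rule subsetI)
    fix M assume M: "M \<in> min_classes ?U"
    then have inU: "M \<in> ?U" and min: "\<And>H. H \<in> ?U \<Longrightarrow> H \<subseteq> M \<Longrightarrow> H = M" by (auto simp: min_classes_def)
    obtain N where N: "N \<in> ?L" "N \<subseteq> M" using down[OF inU] by blast
    then have "N = M" using min LU by blast
    then show "M \<in> min_classes ?L" using N min LU unfolding min_classes_def by blast
  next
    fix M assume "M \<in> min_classes ?L"
    then have inL: "M \<in> ?L" and min: "\<And>H. H \<in> ?L \<Longrightarrow> H \<subseteq> M \<Longrightarrow> H = M" unfolding min_classes_def by blast+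
    have "H = M" if H: "H \<in> ?U" "H \<subseteq> M" for H
    proof -
      obtain N where N: "N \<in> ?L" "N \<subseteq> H" using down[OF H(1)] by blast
      then have "N = M" using min H(2) by blast
      then show ?thesis using N(2) H(2) by blast
    qed
    then show "M \<in> min_classes ?U" using inL LU unfolding min_classes_def by blast
  qed
  then show ?thesis unfolding cobs_def .
qed

end
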